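(* There exists a universal constant $c>0$ such that the following holds. Consider the problem of learning the class $\mathcal{F}$ of homogeneous halfspaces in $\mathbb{R}^d$ with the binary loss, based on an i.i.d. sample of size $n$. Let $\tilde f$ be the output of any learning algorithm. Then for any $1<B\le\sqrt{\frac nd}$ there exists a distribution $P_{X,Y}$ on $\mathbb{R}^d\times\{1,-1\}$ such that the excess loss class $\mathcal{L}_{\mathcal{Y}}$ is $(1,B)$-Bernstein, the marginal $P_X$ is a zero mean isotropic log-concave distribution, and $$\mathbb{E}\left(R(\tilde f)-R(f^* )\right)\ge c\,\frac{Bd}{n}.$$
   Context: A homogeneous halfspace classifier in $\mathbb{R}^d$ is a $\{1,-1\}$-valued linear threshold classifier whose separating hyperplane passes through the origin. The learner observes $(X_i,Y_i)_{i=1}^n$ i.i.d. from $P_{X,Y}$. The binary loss is $\ell(y,y')=\mathbf{1}[y\ne y']$, the risk is $R(f)=\mathbb{E}\,\mathbf{1}[f(X)\ne Y]$, and $f^*$ is a minimizer of $R$ over $\mathcal{F}$. The excess loss class is $\mathcal{L}_{\mathcal{Y}}=\{(x,y)\mapsto\mathbf{1}[f(x)\ne y]-\mathbf{1}[f^*(x)\ne y]:f\in\mathcal{F}\}$. A class $\mathcal{G}$ is $(\beta,B)$-Bernstein, for $\beta\in[0,1]$ and $B>1$, if $Pg^2\le B(Pg)^\beta$ for all $g\in\mathcal{G}$, where $P$ is expectation under $P_{X,Y}$. The expectation in the conclusion is over the sample.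
   Formalization: The dimension is assumed to satisfy d ≥ 2; for d = 1 the claim fails, since there are essentially only two classifiers and for fixed B = 2 empirical risk minimization has excess risk at most exp(−n/8), below 2c/n for large n. *)

theory Defs
  imports "HOL-Probability.Probability"
begin

text \<open>
  The dimension is quantified inside the theorem, so a point of \<open>\<real>\<^sup>d\<close> is an extensional function on
  \<open>{..<d}\<close>. The same object serves as the Borel space \<open>\<real>\<^sup>d\<close> and as \<open>d\<close>-dimensional
  Lebesgue measure.
\<close>

definition Rd :: "nat \<Rightarrow> (nat \<Rightarrow> real) measure" where
  "Rd d = (\<Pi>\<^sub>M i\<in>{..<d}. lborel)"

definition labels :: "int measure" where
  "labels = count_space {1, -1}"

definition examples :: "nat \<Rightarrow> ((nat \<Rightarrow> real) \<times> int) measure" where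
  "examples d = Rd d \<Otimes>\<^sub>M labels"

text \<open>Points on the separating hyperplane are labelled \<open>1\<close>.\<close>

definition halfspace_classifier :: "nat \<Rightarrow> (nat \<Rightarrow> real) \<Rightarrow> (nat \<Rightarrow> real) \<Rightarrow> int" where
  "halfspace_classifier d w x = (if (\<Sum>i<d. w i * x i) \<ge> 0 then 1 else -1)"

definition homogeneous_halfspaces :: "nat \<Rightarrow> ((nat \<Rightarrow> real) \<Rightarrow> int) set" where
  "homogeneous_halfspaces d = {halfspace_classifier d w | w. \<exists>i<d. w i \<noteq> 0}"

definition binary_loss :: "int \<Rightarrow> int \<Rightarrow> real" where
  "binary_loss y y' = of_bool (y \<noteq> y')"

definition risk :: "('x \<times> int) measure \<Rightarrow> ('x \<Rightarrow> int) \<Rightarrow> real" where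
  "risk P f = (\<integral>(x, y). binary_loss (f x) y \<partial>P)"

definition risk_minimizer :: "('x \<times> int) measure \<Rightarrow> ('x \<Rightarrow> int) set \<Rightarrow> ('x \<Rightarrow> int) \<Rightarrow> bool" where
  "risk_minimizer P F fstar \<longleftrightarrow> fstar \<in> F \<and> (\<forall>f\<in>F. risk P fstar \<le> risk P f)"

definition excess_loss_class ::
    "('x \<Rightarrow> int) set \<Rightarrow> ('x \<Rightarrow> int) \<Rightarrow> ('x \<times> int \<Rightarrow> real) set" where
  "excess_loss_class F fstar =
     {\<lambda>(x, y). binary_loss (f x) y - binary_loss (fstar x) y | f. f \<in> F}"

text \<open>The case distinction is needed because \<open>0 powr 0 = 0\<close> in the library.\<close>

definition bernstein_class :: "'z measure \<Rightarrow> ('z \<Rightarrow> real) set \<Rightarrow> real \<Rightarrow> real \<Rightarrow> bool" where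
  "bernstein_class P G \<beta> B \<longleftrightarrow> 0 \<le> \<beta> \<and> \<beta> \<le> 1 \<and> B > 1 \<and>
     (\<forall>g\<in>G. (\<integral>z. (g z)\<^sup>2 \<partial>P) \<le> B * (if \<beta> = 0 then 1 else (\<integral>z. g z \<partial>P) powr \<beta>))"

text \<open>Log-concavity of \<open>p\<close> is stated multiplicatively so that \<open>p\<close> may vanish.\<close>

definition log_concave_distribution :: "nat \<Rightarrow> (nat \<Rightarrow> real) measure \<Rightarrow> bool" where
  "log_concave_distribution d M \<longleftrightarrow>
     (\<exists>p \<in> borel_measurable (Rd d).
        (\<forall>x\<in>space (Rd d). 0 \<le> p x) \<and>
        M = density (Rd d) (\<lambda>x. ennreal (p x)) \<and>
        (\<forall>x\<in>space (Rd d). \<forall>y\<in>space (Rd d). \<forall>t\<in>{0<..<1}.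
           p (\<lambda>i\<in>{..<d}. t * x i + (1 - t) * y i) \<ge> p x powr t * p y powr (1 - t)))"

definition zero_mean :: "nat \<Rightarrow> (nat \<Rightarrow> real) measure \<Rightarrow> bool" where
  "zero_mean d M \<longleftrightarrow> (\<forall>i<d. integrable M (\<lambda>x. x i) \<and> (\<integral>x. x i \<partial>M) = 0)"

text \<open>For a zero mean distribution this says that the covariance matrix is the identity.\<close>

definition isotropic :: "nat \<Rightarrow> (nat \<Rightarrow> real) measure \<Rightarrow> bool" where
  "isotropic d M \<longleftrightarrow>
     (\<forall>i<d. \<forall>j<d. integrable M (\<lambda>x. x i * x j) \<and> (\<integral>x. x i * x j \<partial>M) = of_bool (i = j))"

text \<open>
  A learning algorithm maps a sample of size \<open>n\<close> to a classifier, which need not be a halfspace.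
  Joint measurability in the sample and the point makes the risk of the output a measurable
  function of the sample.
\<close>

definition learning_algorithm ::
    "nat \<Rightarrow> nat \<Rightarrow> ((nat \<Rightarrow> (nat \<Rightarrow> real) \<times> int) \<Rightarrow> (nat \<Rightarrow> real) \<Rightarrow> int) \<Rightarrow> bool" where
  "learning_algorithm d n A \<longleftrightarrow>
     (\<lambda>(S, x). A S x) \<in> measurable ((\<Pi>\<^sub>M i\<in>{..<n}. examples d) \<Otimes>\<^sub>M Rd d) labels"

end

theory Submission imports Defs begin

text \<open>
  The marginal is always the uniform distribution on the cube \<open>[- sqrt 3, sqrt 3]\<^sup>d\<close>, which is isotropic
  and log-concave; only the labels depend on the algorithm. For a halfspace \<open>f\<close> the label of \<open>x\<close> is
  \<open>f x\<close> plus noise, with conditional mean \<open>h * f x\<close>, where \<open>h = 1 / B\<close>. Then \<open>f\<close> is the Bayes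
  classifier, and the excess risk of \<open>g\<close> is exactly \<open>h\<close> times the probability that \<open>g\<close> and \<open>f\<close>
  disagree, whereas the second moment of the excess loss is that probability itself. So the Bernstein
  condition holds with \<open>\<beta> = 1\<close> and constant \<open>1 / h = B\<close>, and it remains to show that some target
  \<open>f\<close> is not recovered up to a disagreement \<open>\<rho>\<close> of order \<open>d / (n h\<^sup>2)\<close>: this makes the excess
  risk of order \<open>h \<rho>\<close>, that is \<open>B d / n\<close>.

  The targets are the \<open>2 ^ (d - 1)\<close> halfspaces \<open>x 0 + \<epsilon> * (\<Sum>i. \<plusminus> x i) \<ge> 0\<close>, indexed by the set \<open>T\<close> of
  plus signs, with \<open>\<epsilon> = \<rho> / sqrt (d - 1)\<close>. Two of them disagree with probability of order
  \<open>\<epsilon> * sqrt k\<close>, where \<open>k\<close> is the Hamming distance of the sign patterns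
  (\<open>tilted_halfspaces_separated\<close>). As this grows only like \<open>sqrt k\<close>, coordinatewise (Assouad) testing
  loses a factor \<open>sqrt d\<close>. Instead all targets are compared at once. A classifier is within
  \<open>\<rho> / 48\<close> of at most a fraction \<open>(3/4) ^ (d - 1)\<close> of the targets, because a Hamming ball of radius
  \<open>(d - 1) / 9\<close> is that small (\<open>hamming_ball_card\<close>, \<open>few_tilted_halfspaces_near\<close>). On the other hand
  there is one reference distribution of the sample under which the likelihood ratio of every target has
  second moment at most \<open>(13/12) ^ (d - 1)\<close>. By the Cauchy-Schwarz inequality the probability of ending up near the
  true target, averaged over the targets, is then at most the square root of \<open>(3/4 * 13/12) ^ (d - 1)\<close>,
  which stays below \<open>1\<close> in every dimension (\<open>weighted_average_lower_bound\<close>).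

  The reference distribution has to work without noise as well as with a lot of it. As \<open>h\<close>
  tends to \<open>1\<close> the labels become deterministic and the chi-square divergence between any two targets
  becomes infinite, so no target can serve as the reference. The reference therefore uses the conditional mean
  \<open>h * sgn (x 0) * (1 - r)\<close> with \<open>r = \<rho>\<^sup>2 / (\<rho>\<^sup>2 + (x 0)\<^sup>2)\<close>: the untilted halfspace with a
  boundary blurred at scale \<open>\<rho>\<close>. Where a target agrees with the untilted halfspace the blur costs at most
  \<open>h\<^sup>2 r\<close>, where they disagree the cost is at most \<open>2 h\<^sup>2 / r\<close>. The first cost has integral of order
  \<open>h\<^sup>2 \<rho>\<close> since \<open>r\<close> is integrable; so has the second one, since \<open>1 / r\<close> grows only quadratically
  and the fourth moment of the tilt \<open>\<epsilon> * (\<Sum>i. \<plusminus> x i)\<close> is at most \<open>3 \<rho> ^ 4\<close>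
  (\<open>chi_square_tilted_halfspace\<close>). The total cost of \<open>n\<close> observations is
  \<open>n h\<^sup>2 \<rho>\<close>, of order \<open>d\<close> by the choice of \<open>\<rho>\<close>.

  The hypothesis \<open>B \<le> sqrt (n / d)\<close> gives \<open>\<rho> \<le> 1 / 40\<close>: the boundaries must mostly stay inside the
  cube for their distance not to be reduced much by clipping.
\<close>

section \<open>Products of measures with a density\<close>

lemma PiM_density:
  fixes g :: "'a \<Rightarrow> real"
  assumes "finite I" and M: "sigma_finite_measure M" and D: "sigma_finite_measure (density M (\<lambda>x. ennreal (g x)))"
    and g[measurable]: "g \<in> borel_measurable M" and nonneg: "\<And>x. x \<in> space M \<Longrightarrow> 0 \<le> g x"
  shows "PiM I (\<lambda>_. density M (\<lambda>x. ennreal (g x)))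
    = density (PiM I (\<lambda>_. M)) (\<lambda>x. ennreal (\<Prod>i\<in>I. g (x i)))"
proof -
  interpret D: product_sigma_finite "\<lambda>_::'b. density M (\<lambda>x. ennreal (g x))"
    unfolding product_sigma_finite_def using D by auto
  interpret P: product_sigma_finite "\<lambda>_::'b. M"
    unfolding product_sigma_finite_def using M by auto
  have "density (PiM I (\<lambda>_. M)) (\<lambda>x. ennreal (\<Prod>i\<in>I. g (x i)))
    = PiM I (\<lambda>_. density M (\<lambda>x. ennreal (g x)))"
  proof (rule D.PiM_eqI[OF \<open>finite I\<close>])
    show "sets (density (PiM I (\<lambda>_. M)) (\<lambda>x. ennreal (\<Prod>i\<in>I. g (x i))))
        = sets (PiM I (\<lambda>_. density M (\<lambda>x. ennreal (g x))))"
      by (auto intro!: sets_PiM_cong)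
    fix A :: "'b \<Rightarrow> 'a set"
    assume "\<And>i. i \<in> I \<Longrightarrow> A i \<in> sets (density M (\<lambda>x. ennreal (g x)))"
    then have A: "\<And>i. i \<in> I \<Longrightarrow> A i \<in> sets M" by simp
    have "emeasure (density (PiM I (\<lambda>_. M)) (\<lambda>x. ennreal (\<Prod>i\<in>I. g (x i)))) (Pi\<^sub>E I A)
        = (\<integral>\<^sup>+x. ennreal (\<Prod>i\<in>I. g (x i)) * indicator (Pi\<^sub>E I A) x \<partial>PiM I (\<lambda>_. M))"
      using A by (intro emeasure_density) (auto intro!: sets_PiM_I_finite assms)
    also have "\<dots> = (\<integral>\<^sup>+x. (\<Prod>i\<in>I. ennreal (g (x i)) * indicator (A i) (x i)) \<partial>PiM I (\<lambda>_. M))"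
    proof (rule nn_integral_cong)
      fix x :: "'b \<Rightarrow> 'a" assume x: "x \<in> space (PiM I (\<lambda>_. M))"
      then have "x \<in> extensional I" by (auto simp: space_PiM PiE_iff)
      then have "(indicator (Pi\<^sub>E I A) x :: ennreal) = (\<Prod>i\<in>I. indicator (A i) (x i))"
        using \<open>finite I\<close> by (auto simp: indicator_def PiE_iff prod.If_cases intro!: prod_zero[symmetric])
      then show "ennreal (\<Prod>i\<in>I. g (x i)) * indicator (Pi\<^sub>E I A) x
          = (\<Prod>i\<in>I. ennreal (g (x i)) * indicator (A i) (x i))"
        using x by (subst prod_ennreal[symmetric]) (auto simp: prod.distrib space_PiM PiE_iff intro!: nonneg)
    qed
    also have "\<dots> = (\<Prod>i\<in>I. \<integral>\<^sup>+x. ennreal (g x) * indicator (A i) x \<partial>M)"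
      using A by (intro P.product_nn_integral_prod[OF \<open>finite I\<close>]) auto
    also have "\<dots> = (\<Prod>i\<in>I. emeasure (density M (\<lambda>x. ennreal (g x))) (A i))"
      using A by (intro prod.cong refl) (simp add: emeasure_density)
    finally show "emeasure (density (PiM I (\<lambda>_. M)) (\<lambda>x. ennreal (\<Prod>i\<in>I. g (x i)))) (Pi\<^sub>E I A)
        = (\<Prod>i\<in>I. emeasure (density M (\<lambda>x. ennreal (g x))) (A i))" .
  qed
  then show ?thesis by simp
qed

section \<open>Noisy labels\<close>

abbreviation fair_sign :: "int measure" where
  "fair_sign \<equiv> uniform_count_measure {1, -1}"

lemma prob_space_fair_sign: "prob_space fair_sign"
  by (rule prob_space_uniform_count_measure) auto

lemma nn_integral_fair_sign: "(\<integral>\<^sup>+y. F y \<partial>fair_sign) = (F 1 + F (-1)) / 2"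
proof -
  have "(\<integral>\<^sup>+y. F y \<partial>fair_sign) = (\<Sum>y\<in>{1, -1}. ennreal (1 / 2) * F y)"
    unfolding uniform_count_measure_def by (subst nn_integral_point_measure_finite) auto
  also have "ennreal (1 / 2) = 1 / 2" by (simp add: divide_ennreal_def ennreal_divide_numeral)
  finally show ?thesis
    by (simp add: divide_ennreal_def distrib_left distrib_right mult.commute)
qed

lemma measurable_sign[measurable]:
  "f \<in> measurable M fair_sign \<Longrightarrow> (\<lambda>x. real_of_int (f x)) \<in> borel_measurable M"
  by (rule measurable_compose[of f M fair_sign]) (auto simp: measurable_def sets_uniform_count_measure space_uniform_count_measure)

text \<open>
  The base measure gives both labels weight \<open>1/2\<close>, so that a label with conditional mean \<open>\<eta> x\<close> has
  density \<open>1 + y * \<eta> x\<close> and all hypotheses are dominated by one probability measure.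
\<close>

definition label_density :: "('x \<Rightarrow> real) \<Rightarrow> 'x \<times> int \<Rightarrow> real" where
  "label_density \<eta> z = 1 + of_int (snd z) * \<eta> (fst z)"

lemma label_density_measurable[measurable]:
  assumes [measurable]: "\<eta> \<in> borel_measurable \<mu>"
  shows "label_density \<eta> \<in> borel_measurable (\<mu> \<Otimes>\<^sub>M fair_sign)"
  unfolding label_density_def[abs_def] by measurable

lemma label_density_nonneg:
  assumes "\<And>x. x \<in> space \<mu> \<Longrightarrow> \<bar>\<eta> x\<bar> \<le> 1" "z \<in> space (\<mu> \<Otimes>\<^sub>M fair_sign)"
  shows "0 \<le> label_density \<eta> z"
  using assms(2) assms(1)[of "fst z"]
  by (auto simp: label_density_def space_pair_measure space_uniform_count_measure abs_le_iff)

definition label_noise :: "'x measure \<Rightarrow> ('x \<Rightarrow> real) \<Rightarrow> ('x \<times> int) measure" where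
  "label_noise \<mu> \<eta> = density (\<mu> \<Otimes>\<^sub>M fair_sign) (\<lambda>z. ennreal (label_density \<eta> z))"

lemma sets_label_noise: "sets (label_noise \<mu> \<eta>) = sets (\<mu> \<Otimes>\<^sub>M fair_sign)"
  by (simp add: label_noise_def)

lemma nn_integral_pair_fair_sign:
  assumes [measurable]: "F \<in> borel_measurable (\<mu> \<Otimes>\<^sub>M fair_sign)"
  shows "(\<integral>\<^sup>+z. F z \<partial>(\<mu> \<Otimes>\<^sub>M fair_sign)) = (\<integral>\<^sup>+x. (F (x, 1) + F (x, -1)) / 2 \<partial>\<mu>)"
proof -
  interpret F: prob_space fair_sign by (rule prob_space_fair_sign)
  show ?thesis
    by (subst F.nn_integral_fst[symmetric]) (auto simp: nn_integral_fair_sign)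
qed

lemma nn_integral_label_noise:
  assumes [measurable]: "\<eta> \<in> borel_measurable \<mu>" "F \<in> borel_measurable (\<mu> \<Otimes>\<^sub>M fair_sign)"
  shows "(\<integral>\<^sup>+z. F z \<partial>label_noise \<mu> \<eta>)
    = (\<integral>\<^sup>+x. (ennreal (1 + \<eta> x) * F (x, 1) + ennreal (1 - \<eta> x) * F (x, -1)) / 2 \<partial>\<mu>)"
  unfolding label_noise_def
  by (subst nn_integral_density) (auto simp: nn_integral_pair_fair_sign label_density_def)

lemma distr_fst_label_noise:
  assumes [measurable]: "\<eta> \<in> borel_measurable \<mu>" and bound: "\<And>x. x \<in> space \<mu> \<Longrightarrow> \<bar>\<eta> x\<bar> \<le> 1"
    and N: "sets N = sets \<mu>"
  shows "distr (label_noise \<mu> \<eta>) N fst = \<mu>"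
proof (rule measure_eqI)
  have fst: "fst \<in> measurable (label_noise \<mu> \<eta>) N"
    using N by (simp add: measurable_cong_sets[OF sets_label_noise N])
  fix A assume "A \<in> sets (distr (label_noise \<mu> \<eta>) N fst)"
  then have A[measurable]: "A \<in> sets \<mu>" using N by simp
  have "emeasure (distr (label_noise \<mu> \<eta>) N fst) A = (\<integral>\<^sup>+z. indicator A z \<partial>distr (label_noise \<mu> \<eta>) N fst)"
    using A N by simp
  also have "\<dots> = (\<integral>\<^sup>+z. indicator A (fst z) \<partial>label_noise \<mu> \<eta>)"
    using A N fst by (intro nn_integral_distr) auto
  also have "\<dots> = (\<integral>\<^sup>+x. (ennreal (1 + \<eta> x) * indicator A x + ennreal (1 - \<eta> x) * indicator A x) / 2 \<partial>\<mu>)"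
    by (subst nn_integral_label_noise) auto
  also have "\<dots> = (\<integral>\<^sup>+x. indicator A x \<partial>\<mu>)"
  proof (rule nn_integral_cong)
    fix x assume "x \<in> space \<mu>"
    then have "\<bar>\<eta> x\<bar> \<le> 1" by (rule bound)
    then have "ennreal (1 + \<eta> x) + ennreal (1 - \<eta> x) = 2"
      by (subst ennreal_plus[symmetric]) auto
    then have "ennreal (1 + \<eta> x) * indicator A x + ennreal (1 - \<eta> x) * indicator A x = 2 * indicator A x"
      by (simp add: distrib_right[symmetric])
    then show "(ennreal (1 + \<eta> x) * indicator A x + ennreal (1 - \<eta> x) * indicator A x) / 2 = indicator A x"
      by (auto simp: indicator_def)
  qed
  finally show "emeasure (distr (label_noise \<mu> \<eta>) N fst) A = emeasure \<mu> A" by simp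
qed (simp add: N)

lemma prob_space_label_noise:
  assumes \<mu>: "prob_space \<mu>" and \<eta>: "\<eta> \<in> borel_measurable \<mu>" "\<And>x. x \<in> space \<mu> \<Longrightarrow> \<bar>\<eta> x\<bar> \<le> 1"
  shows "prob_space (label_noise \<mu> \<eta>)"
proof -
  have fst: "fst \<in> measurable (label_noise \<mu> \<eta>) \<mu>"
    by (simp add: measurable_cong_sets[OF sets_label_noise refl])
  show ?thesis
    using \<mu> distr_fst_label_noise[OF \<eta> refl] prob_space_distrD[OF fst] by simp
qed

lemma integral_label_noise:
  fixes G :: "'x \<times> int \<Rightarrow> real"
  assumes \<mu>: "prob_space \<mu>" and \<eta>[measurable]: "\<eta> \<in> borel_measurable \<mu>" and bound: "\<And>x. x \<in> space \<mu> \<Longrightarrow> \<bar>\<eta> x\<bar> \<le> 1"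
    and [measurable]: "G \<in> borel_measurable (\<mu> \<Otimes>\<^sub>M fair_sign)" and G: "\<And>z. \<bar>G z\<bar> \<le> C"
  shows "(\<integral>z. G z \<partial>label_noise \<mu> \<eta>) = (\<integral>x. ((1 + \<eta> x) * G (x, 1) + (1 - \<eta> x) * G (x, -1)) / 2 \<partial>\<mu>)"
proof -
  interpret \<mu>: prob_space \<mu> by fact
  interpret F: prob_space fair_sign by (rule prob_space_fair_sign)
  interpret P: pair_prob_space \<mu> fair_sign ..
  have le_2: "\<bar>1 + \<eta> x\<bar> \<le> 2" "\<bar>1 - \<eta> x\<bar> \<le> 2" if "x \<in> space \<mu>" for x
    using bound[OF that] by auto
  have C: "0 \<le> C" using G[of undefined] by linarith
  have "(\<integral>z. G z \<partial>label_noise \<mu> \<eta>)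
      = (\<integral>z. label_density \<eta> z *\<^sub>R G z \<partial>(\<mu> \<Otimes>\<^sub>M fair_sign))"
    unfolding label_noise_def
    by (intro integral_density AE_I2 label_density_nonneg[OF bound]) auto
  also have "\<dots> = (\<integral>z. (1 + of_int (snd z) * \<eta> (fst z)) *\<^sub>R G z \<partial>(\<mu> \<Otimes>\<^sub>M fair_sign))"
    by (simp add: label_density_def)
  also have "\<dots> = (\<integral>x. \<integral>y. (1 + of_int y * \<eta> x) *\<^sub>R G (x, y) \<partial>fair_sign \<partial>\<mu>)"
  proof (subst P.integral_fst'[symmetric])
    show "integrable (\<mu> \<Otimes>\<^sub>M fair_sign) (\<lambda>z. (1 + of_int (snd z) * \<eta> (fst z)) *\<^sub>R G z)"
    proof (rule P.integrable_const_bound[of _ "2 * C"])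
      show "AE z in \<mu> \<Otimes>\<^sub>M fair_sign. norm ((1 + of_int (snd z) * \<eta> (fst z)) *\<^sub>R G z) \<le> 2 * C"
        using le_2 G C
        by (intro AE_I2) (auto simp: space_pair_measure space_uniform_count_measure abs_mult intro!: mult_mono)
    qed simp
  qed auto
  also have "\<dots> = (\<integral>x. ((1 + \<eta> x) * G (x, 1) + (1 - \<eta> x) * G (x, -1)) / 2 \<partial>\<mu>)"
    by (simp add: integral_uniform_count_measure)
  finally show ?thesis .
qed

lemma measurable_disagree[measurable]:
  assumes [measurable]: "f \<in> measurable \<mu> fair_sign" "g \<in> measurable \<mu> fair_sign"
  shows "Measurable.pred \<mu> (\<lambda>x. g x \<noteq> f x)"
proof -
  have "Measurable.pred \<mu> (\<lambda>x. real_of_int (g x) \<noteq> real_of_int (f x))" by measurable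
  then show ?thesis by simp
qed

lemma measurable_binary_loss:
  "k \<in> measurable \<mu> fair_sign \<Longrightarrow> (\<lambda>z. binary_loss (k (fst z)) (snd z)) \<in> borel_measurable (\<mu> \<Otimes>\<^sub>M fair_sign)"
proof -
  assume [measurable]: "k \<in> measurable \<mu> fair_sign"
  have "(\<lambda>z. of_bool (real_of_int (k (fst z)) \<noteq> real_of_int (snd z)) :: real) \<in> borel_measurable (\<mu> \<Otimes>\<^sub>M fair_sign)"
    unfolding of_bool_def by measurable
  then show ?thesis by (simp add: binary_loss_def)
qed

lemma integral_label_density:
  assumes \<mu>: "prob_space \<mu>" and \<eta>[measurable]: "\<eta> \<in> borel_measurable \<mu>" and bound: "\<And>x. x \<in> space \<mu> \<Longrightarrow> \<bar>\<eta> x\<bar> \<le> 1"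
  shows "integrable (\<mu> \<Otimes>\<^sub>M fair_sign) (label_density \<eta>)"
    and "(\<integral>z. label_density \<eta> z \<partial>(\<mu> \<Otimes>\<^sub>M fair_sign)) = 1"
proof -
  interpret P: prob_space "label_noise \<mu> \<eta>" by (rule prob_space_label_noise[OF \<mu> \<eta> bound])
  have "(\<integral>\<^sup>+z. ennreal (label_density \<eta> z) \<partial>(\<mu> \<Otimes>\<^sub>M fair_sign)) = (\<integral>\<^sup>+z. 1 \<partial>label_noise \<mu> \<eta>)"
    unfolding label_noise_def by (subst nn_integral_density) auto
  then have nn: "(\<integral>\<^sup>+z. ennreal (label_density \<eta> z) \<partial>(\<mu> \<Otimes>\<^sub>M fair_sign)) = ennreal 1"
    using P.emeasure_space_1 by simp
  have nonneg: "AE z in \<mu> \<Otimes>\<^sub>M fair_sign. 0 \<le> label_density \<eta> z"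
    by (intro AE_I2 label_density_nonneg[OF bound])
  show "integrable (\<mu> \<Otimes>\<^sub>M fair_sign) (label_density \<eta>)"
    by (rule integrableI_nn_integral_finite[OF _ nonneg nn]) measurable
  show "(\<integral>z. label_density \<eta> z \<partial>(\<mu> \<Otimes>\<^sub>M fair_sign)) = 1"
    using nn by (subst integral_eq_nn_integral[OF _ nonneg]) auto
qed

context
  fixes \<mu> :: "'x measure" and f g :: "'x \<Rightarrow> int" and h :: real
  assumes \<mu>: "prob_space \<mu>" and f[measurable]: "f \<in> measurable \<mu> fair_sign" and g[measurable]: "g \<in> measurable \<mu> fair_sign"
    and h: "0 \<le> h" "h \<le> 1"
begin

lemma sign_cases: "x \<in> space \<mu> \<Longrightarrow> f x = 1 \<or> f x = -1" "x \<in> space \<mu> \<Longrightarrow> g x = 1 \<or> g x = -1"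
  using measurable_space[OF f, of x] measurable_space[OF g, of x] by (auto simp: space_uniform_count_measure)

lemma bias_le_1: "x \<in> space \<mu> \<Longrightarrow> \<bar>h * of_int (f x)\<bar> \<le> 1"
  using sign_cases(1)[of x] h by auto

lemmas measurable_losses[measurable] = measurable_binary_loss[OF f] measurable_binary_loss[OF g]

text \<open>
  If \<open>g x = f x\<close> the losses cancel; otherwise the excess loss is \<open>1\<close> or \<open>-1\<close> with probabilities
  \<open>(1 + h) / 2\<close> and \<open>(1 - h) / 2\<close>. This fixes both moments of the excess loss.
\<close>

lemma excess_loss_mean:
  "(\<integral>z. binary_loss (g (fst z)) (snd z) - binary_loss (f (fst z)) (snd z) \<partial>label_noise \<mu> (\<lambda>x. h * of_int (f x)))
   = h * measure \<mu> {x \<in> space \<mu>. g x \<noteq> f x}"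
proof -
  interpret \<mu>: prob_space \<mu> by (rule \<mu>)
  have "(\<integral>z. binary_loss (g (fst z)) (snd z) - binary_loss (f (fst z)) (snd z) \<partial>label_noise \<mu> (\<lambda>x. h * of_int (f x)))
     = (\<integral>x. h * indicator {x \<in> space \<mu>. g x \<noteq> f x} x \<partial>\<mu>)"
    apply (subst integral_label_noise[OF \<mu>, where C = 1])
    subgoal by simp
    subgoal by (rule bias_le_1)
    subgoal by simp
    subgoal by (simp add: binary_loss_def)
    apply (rule Bochner_Integration.integral_cong[OF refl])
    subgoal for x using sign_cases[of x] by (auto simp: binary_loss_def indicator_def field_simps)
    done
  also have "\<dots> = h * measure \<mu> {x \<in> space \<mu>. g x \<noteq> f x}" by simp
  finally show ?thesis .
qed

lemma excess_loss_second_moment: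
  "(\<integral>z. (binary_loss (g (fst z)) (snd z) - binary_loss (f (fst z)) (snd z))\<^sup>2 \<partial>label_noise \<mu> (\<lambda>x. h * of_int (f x)))
   = measure \<mu> {x \<in> space \<mu>. g x \<noteq> f x}"
proof -
  interpret \<mu>: prob_space \<mu> by (rule \<mu>)
  have "(\<integral>z. (binary_loss (g (fst z)) (snd z) - binary_loss (f (fst z)) (snd z))\<^sup>2 \<partial>label_noise \<mu> (\<lambda>x. h * of_int (f x)))
     = (\<integral>x. indicator {x \<in> space \<mu>. g x \<noteq> f x} x \<partial>\<mu>)"
    apply (subst integral_label_noise[OF \<mu>, where C = 1])
    subgoal by simp
    subgoal by (rule bias_le_1)
    subgoal by simp
    subgoal by (simp add: binary_loss_def)
    apply (rule Bochner_Integration.integral_cong[OF refl])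
    subgoal for x using sign_cases[of x] by (auto simp: binary_loss_def indicator_def field_simps)
    done
  also have "\<dots> = measure \<mu> {x \<in> space \<mu>. g x \<noteq> f x}" by simp
  finally show ?thesis .
qed

lemma excess_risk_label_noise:
  "risk (label_noise \<mu> (\<lambda>x. h * of_int (f x))) g - risk (label_noise \<mu> (\<lambda>x. h * of_int (f x))) f
   = h * measure \<mu> {x \<in> space \<mu>. g x \<noteq> f x}"
proof -
  interpret P: prob_space "label_noise \<mu> (\<lambda>x. h * of_int (f x))"
    by (rule prob_space_label_noise[OF \<mu>]) (auto simp: bias_le_1)
  have int: "integrable (label_noise \<mu> (\<lambda>x. h * of_int (f x))) (\<lambda>z. binary_loss (k (fst z)) (snd z))"
    if "k \<in> measurable \<mu> fair_sign" for k
    using measurable_binary_loss[OF that]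
    by (intro P.integrable_const_bound[of _ 1])
       (auto simp: binary_loss_def measurable_cong_sets[OF sets_label_noise refl])
  show ?thesis
    unfolding risk_def case_prod_beta excess_loss_mean[symmetric]
    by (intro Bochner_Integration.integral_diff[symmetric] int f g)
qed

end

section \<open>Many hypotheses and one reference distribution\<close>

text \<open>
  A form of Fano's method with the chi-square divergence. Here \<open>g i\<close> is the density of the sample under
  hypothesis \<open>i\<close>, \<open>q\<close> a reference density, and \<open>D i\<close> the loss. By Markov's inequality it suffices to bound
  the average mass of the events \<open>D i \<le> t\<close>. Cauchy-Schwarz transfers this mass to \<open>q\<close>, at the price of
  the second moment of \<open>g i / q\<close>; under \<open>q\<close> the average is at most \<open>\<kappa>\<close>, because at each sample only a
  fraction \<open>\<kappa>\<close> of the events can happen together. Cauchy-Schwarz is used in its pointwise form (Young's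
  inequality), with \<open>\<theta>\<close> the parameter to be optimised, so that only linearity of the integral is needed.
\<close>

lemma weighted_average_lower_bound:
  fixes g :: "'i \<Rightarrow> 's \<Rightarrow> real" and q :: "'s \<Rightarrow> real"
  assumes fin: "finite I"
    and g: "\<And>i. i \<in> I \<Longrightarrow> integrable M (g i)" "\<And>i. i \<in> I \<Longrightarrow> (\<integral>s. g i s \<partial>M) = 1"
      "\<And>i s. i \<in> I \<Longrightarrow> s \<in> space M \<Longrightarrow> 0 \<le> g i s"
    and q: "integrable M q" "(\<integral>s. q s \<partial>M) = 1" "\<And>s. s \<in> space M \<Longrightarrow> 0 < q s"
    and chi: "\<And>i. i \<in> I \<Longrightarrow> integrable M (\<lambda>s. (g i s)\<^sup>2 / q s)"
      "\<And>i. i \<in> I \<Longrightarrow> (\<integral>s. (g i s)\<^sup>2 / q s \<partial>M) \<le> K"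
    and D: "\<And>i. i \<in> I \<Longrightarrow> D i \<in> borel_measurable M"
      "\<And>i s. i \<in> I \<Longrightarrow> s \<in> space M \<Longrightarrow> 0 \<le> D i s \<and> D i s \<le> 1"
    and "0 \<le> t" "0 < \<theta>"
    and few: "\<And>s. s \<in> space M \<Longrightarrow> real (card {i \<in> I. D i s \<le> t}) \<le> \<kappa> * real (card I)"
  shows "(\<Sum>i\<in>I. \<integral>s. D i s * g i s \<partial>M) \<ge> real (card I) * (t * (1 - \<theta> * K / 2 - \<kappa> / (2 * \<theta>)))"
proof -
  have young: "u * b \<le> \<theta> / 2 * (u\<^sup>2 / v) + v * b / (2 * \<theta>)" if "v > 0" "b = 0 \<or> b = 1" for u v b :: real
  proof -
    have "0 \<le> (\<theta> * u - v)\<^sup>2 / (2 * \<theta> * v)" using \<open>0 < \<theta>\<close> \<open>0 < v\<close> by simp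
    also have "\<dots> = \<theta> / 2 * (u\<^sup>2 / v) + v / (2 * \<theta>) - u"
      using \<open>0 < \<theta>\<close> \<open>0 < v\<close> by (simp add: field_simps power2_eq_square)
    finally have "u \<le> \<theta> / 2 * (u\<^sup>2 / v) + v / (2 * \<theta>)" by simp
    moreover have "0 \<le> \<theta> / 2 * (u\<^sup>2 / v)" using \<open>0 < \<theta>\<close> \<open>0 < v\<close> by simp
    ultimately show ?thesis using that(2) by auto
  qed
  have Dg: "integrable M (\<lambda>s. D i s * g i s)" if "i \<in> I" for i
    using D[OF that] g(3)[OF that] g(1)[OF that]
    by (intro Bochner_Integration.integrable_bound[OF g(1)[OF that]] AE_I2)
       (auto simp: abs_mult mult_left_le_one_le)
  define r where "r i s = (g i s)\<^sup>2 / q s" for i s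
  have r: "integrable M (r i)" "(\<integral>s. r i s \<partial>M) \<le> K" if "i \<in> I" for i
    using chi[OF that] by (simp_all add: r_def[abs_def])
  have "real (card I) * (t * (1 - \<theta> * K / 2 - \<kappa> / (2 * \<theta>)))
      = (\<Sum>i\<in>I. t * (1 - \<theta> / 2 * K)) - t * (\<kappa> * real (card I) / (2 * \<theta>))"
    by (simp add: field_simps)
  also have "\<dots> \<le> (\<Sum>i\<in>I. t * ((\<integral>s. g i s \<partial>M) - \<theta> / 2 * (\<integral>s. r i s \<partial>M)))
      - t * (\<integral>s. q s * (\<kappa> * real (card I)) / (2 * \<theta>) \<partial>M)"
    using g(2) r(2) q(2) \<open>0 \<le> t\<close> \<open>0 < \<theta>\<close> by (intro diff_mono sum_mono mult_left_mono) auto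
  also have "\<dots> = (\<integral>s. (\<Sum>i\<in>I. t * (g i s - \<theta> / 2 * r i s))
      - t * (q s * (\<kappa> * real (card I)) / (2 * \<theta>)) \<partial>M)"
    using g(1) r(1) q(1) fin by (subst Bochner_Integration.integral_diff) (auto simp: Bochner_Integration.integral_sum)
  also have "\<dots> \<le> (\<integral>s. (\<Sum>i\<in>I. D i s * g i s) \<partial>M)"
  proof (rule integral_mono)
    fix s assume s: "s \<in> space M"
    define b where "b i = (of_bool (D i s \<le> t) :: real)" for i
    have "(\<Sum>i\<in>I. b i) = real (card {i \<in> I. D i s \<le> t})"
      unfolding b_def of_bool_def using fin by (simp add: sum.If_cases Int_def)
    then have cnt: "(\<Sum>i\<in>I. b i) \<le> \<kappa> * real (card I)" using few[OF s] by simp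
    have le: "t * (g i s - \<theta> / 2 * r i s) - t * (q s * b i / (2 * \<theta>)) \<le> D i s * g i s" if "i \<in> I" for i
    proof -
      have "t * (g i s - \<theta> / 2 * r i s) - t * (q s * b i / (2 * \<theta>))
          = t * (g i s - (\<theta> / 2 * r i s + q s * b i / (2 * \<theta>)))"
        by (simp add: algebra_simps)
      also have "\<dots> \<le> t * (g i s - g i s * b i)"
        using young[OF q(3)[OF s], of "b i" "g i s", folded r_def] \<open>0 \<le> t\<close> by (intro mult_left_mono) (auto simp: b_def)
      also have "\<dots> \<le> D i s * g i s"
        using D(2)[OF that s] g(3)[OF that s] by (auto simp: b_def intro!: mult_right_mono)
      finally show ?thesis .
    qed
    have "(\<Sum>i\<in>I. t * (g i s - \<theta> / 2 * r i s)) - t * (q s * (\<kappa> * real (card I)) / (2 * \<theta>))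
        \<le> (\<Sum>i\<in>I. t * (g i s - \<theta> / 2 * r i s)) - t * (q s * (\<Sum>i\<in>I. b i) / (2 * \<theta>))"
      using cnt \<open>0 \<le> t\<close> \<open>0 < \<theta>\<close> q(3)[OF s]
      by (intro diff_left_mono mult_left_mono divide_right_mono) auto
    also have "\<dots> = (\<Sum>i\<in>I. t * (g i s - \<theta> / 2 * r i s) - t * (q s * b i / (2 * \<theta>)))"
      by (simp add: sum_subtractf sum_distrib_left sum_divide_distrib)
    also have "\<dots> \<le> (\<Sum>i\<in>I. D i s * g i s)" by (intro sum_mono le)
    finally show "(\<Sum>i\<in>I. t * (g i s - \<theta> / 2 * r i s)) - t * (q s * (\<kappa> * real (card I)) / (2 * \<theta>))
        \<le> (\<Sum>i\<in>I. D i s * g i s)" .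
  qed (use g(1) r(1) q(1) Dg in \<open>auto intro!: Bochner_Integration.integrable_sum\<close>)
  also have "\<dots> = (\<Sum>i\<in>I. \<integral>s. D i s * g i s \<partial>M)"
    using Dg by (rule Bochner_Integration.integral_sum)
  finally show ?thesis by simp
qed

section \<open>Hamming balls\<close>

lemma sum_power_card_Pow:
  "finite I \<Longrightarrow> (\<Sum>T\<in>Pow I. (z::real) ^ card T) = (1 + z) ^ card I"
  using prod_add[of I "\<lambda>_. z" "\<lambda>_. 1"] by (simp add: add.commute)

text \<open>
  An exponential moment bound: each \<open>T\<close> in the ball satisfies \<open>u ^ (9 * k) \<ge> u ^ m\<close>, with \<open>k\<close> its distance
  from the centre and \<open>m = card I\<close>, while \<open>u ^ (9 * k)\<close> summed over all \<open>T\<close> gives \<open>(1 + u ^ 9) ^ m\<close>.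
  At \<open>u = 4/5\<close> the quotient \<open>(1 + u ^ 9) / u\<close> is below \<open>3/2\<close>.
\<close>

lemma hamming_ball_card:
  assumes fin: "finite I" and T0: "T0 \<subseteq> I"
  shows "real (card {T \<in> Pow I. 9 * card (sym_diff T T0) \<le> card I}) \<le> (3/4) ^ card I * 2 ^ card I"
proof -
  let ?m = "card I" and ?u = "4/5 :: real"
  let ?B = "{T \<in> Pow I. 9 * card (sym_diff T T0) \<le> card I}"
  have bij: "bij_betw (\<lambda>T. sym_diff T T0) (Pow I) (Pow I)"
    by (rule bij_betwI[where g = "\<lambda>T. sym_diff T T0"]) (use T0 in auto)
  have "real (card ?B) * ?u ^ ?m = (\<Sum>T\<in>?B. ?u ^ ?m)" by simp
  also have "\<dots> \<le> (\<Sum>T\<in>?B. (?u ^ 9) ^ card (sym_diff T T0))"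
    by (rule sum_mono) (auto simp: power_mult[symmetric] intro!: power_decreasing)
  also have "\<dots> \<le> (\<Sum>T\<in>Pow I. (?u ^ 9) ^ card (sym_diff T T0))"
    using fin by (intro sum_mono2) auto
  also have "\<dots> = (\<Sum>T\<in>Pow I. (?u ^ 9) ^ card T)"
    by (rule sum.reindex_bij_betw[OF bij])
  also have "\<dots> = (1 + ?u ^ 9) ^ ?m" using fin by (rule sum_power_card_Pow)
  also have "\<dots> \<le> (3/2 * ?u) ^ ?m"
    by (rule power_mono) (auto simp: eval_nat_numeral)
  also have "\<dots> = ((3/4) ^ ?m * 2 ^ ?m) * ?u ^ ?m" by (simp add: power_mult_distrib[symmetric])
  finally show ?thesis by simp
qed

section \<open>The uniform distribution on a cube\<close>

text \<open>
  The half-length \<open>sqrt 3\<close> makes the variance \<open>1\<close>.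
\<close>

definition unif :: "real measure" where
  "unif = density lborel (\<lambda>t. ennreal (indicator {- sqrt 3..sqrt 3} t / (2 * sqrt 3)))"

lemma sets_unif[measurable_cong, simp]: "sets unif = sets borel"
  by (simp add: unif_def)

lemma space_unif[simp]: "space unif = UNIV"
  by (simp add: unif_def)

lemma nn_integral_unif:
  assumes [measurable]: "f \<in> borel_measurable borel"
  shows "(\<integral>\<^sup>+t. f t \<partial>unif) = ennreal (1 / (2 * sqrt 3)) * (\<integral>\<^sup>+t. f t * indicator {- sqrt 3..sqrt 3} t \<partial>lborel)"
proof -
  have "(\<integral>\<^sup>+t. f t \<partial>unif) = (\<integral>\<^sup>+t. ennreal (indicator {- sqrt 3..sqrt 3} t / (2 * sqrt 3)) * f t \<partial>lborel)"
    unfolding unif_def by (subst nn_integral_density) auto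
  also have "\<dots> = (\<integral>\<^sup>+t. ennreal (1 / (2 * sqrt 3)) * (f t * indicator {- sqrt 3..sqrt 3} t) \<partial>lborel)"
    by (intro nn_integral_cong) (auto simp: indicator_def)
  also have "\<dots> = ennreal (1 / (2 * sqrt 3)) * (\<integral>\<^sup>+t. f t * indicator {- sqrt 3..sqrt 3} t \<partial>lborel)"
    by (rule nn_integral_cmult) auto
  finally show ?thesis .
qed

lemma prob_space_unif: "prob_space unif"
proof
  have "emeasure unif (space unif) = (\<integral>\<^sup>+t. 1 \<partial>unif)" by simp
  also have "\<dots> = ennreal (1 / (2 * sqrt 3)) * emeasure lborel {- sqrt 3..sqrt 3}"
    by (subst nn_integral_unif) auto
  also have "\<dots> = 1" by (simp add: ennreal_mult[symmetric])
  finally show "emeasure unif (space unif) = 1" .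
qed

interpretation unif: prob_space unif by (rule prob_space_unif)

interpretation unifs: product_sigma_finite "\<lambda>_::nat. unif" ..

lemma measure_unif_UNIV[simp]: "measure unif UNIV = 1"
  using unif.prob_space by simp

lemma integral_unif_FTC:
  assumes F: "\<And>t. (F has_real_derivative f t) (at t)" and f: "\<And>t. isCont f t"
  shows "(\<integral>t. f t \<partial>unif) = (F (sqrt 3) - F (- sqrt 3)) / (2 * sqrt 3)"
proof -
  have [measurable]: "f \<in> borel_measurable borel"
    using f by (intro borel_measurable_continuous_onI) (simp add: continuous_on_eq_continuous_at)
  have "(\<integral>t. f t \<partial>unif) = (\<integral>t. (indicator {- sqrt 3..sqrt 3} t / (2 * sqrt 3)) *\<^sub>R f t \<partial>lborel)"
    unfolding unif_def by (intro integral_density) auto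
  also have "\<dots> = (\<integral>t. f t * indicator {- sqrt 3..sqrt 3} t \<partial>lborel) / (2 * sqrt 3)"
    by (subst Bochner_Integration.integral_divide_zero[symmetric]) (simp add: mult.commute)
  also have "(\<integral>t. f t * indicator {- sqrt 3..sqrt 3} t \<partial>lborel) = F (sqrt 3) - F (- sqrt 3)"
    using F f by (intro integral_FTC_Icc_real) auto
  finally show ?thesis .
qed

lemma unif_moments:
  "(\<integral>t. t \<partial>unif) = 0" "(\<integral>t. t\<^sup>2 \<partial>unif) = 1" "(\<integral>t. t ^ 3 \<partial>unif) = 0" "(\<integral>t. t ^ 4 \<partial>unif) = 9 / 5"
proof -
  have *: "sqrt 3 ^ 3 = 3 * sqrt 3" "sqrt 3 ^ 4 = (9::real)" "sqrt 3 ^ 5 = 9 * sqrt (3::real)"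
    by (simp_all add: eval_nat_numeral)
  show "(\<integral>t. t \<partial>unif) = 0"
    by (subst integral_unif_FTC[where F = "\<lambda>t. t\<^sup>2 / 2"]) (auto intro!: derivative_eq_intros)
  show "(\<integral>t. t\<^sup>2 \<partial>unif) = 1"
    by (subst integral_unif_FTC[where F = "\<lambda>t. t ^ 3 / 3"]) (auto intro!: derivative_eq_intros simp: *)
  show "(\<integral>t. t ^ 3 \<partial>unif) = 0"
    by (subst integral_unif_FTC[where F = "\<lambda>t. t ^ 4 / 4"]) (auto intro!: derivative_eq_intros simp: *)
  show "(\<integral>t. t ^ 4 \<partial>unif) = 9 / 5"
    by (subst integral_unif_FTC[where F = "\<lambda>t. t ^ 5 / 5"]) (auto intro!: derivative_eq_intros simp: *)
qed

lemma AE_unif_bounded: "AE t in unif. \<bar>t\<bar> \<le> sqrt 3"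
  unfolding unif_def by (subst AE_density) (auto simp: indicator_def)

lemma integrable_unif_power: "integrable unif (\<lambda>t. t ^ k)"
  using AE_unif_bounded
  by (intro unif.integrable_const_bound[of _ "sqrt 3 ^ k"]) (auto simp: power_abs intro!: power_mono elim!: eventually_mono)

definition linear_form :: "nat set \<Rightarrow> (nat \<Rightarrow> real) \<Rightarrow> (nat \<Rightarrow> real) \<Rightarrow> real" where
  "linear_form I a x = (\<Sum>i\<in>I. a i * x i)"

lemma linear_form_measurable[measurable]: "linear_form I a \<in> borel_measurable (PiM I (\<lambda>_. unif))"
  unfolding linear_form_def[abs_def] by measurable

lemma linear_form_update: "finite I \<Longrightarrow> j \<notin> I \<Longrightarrow> linear_form (insert j I) a (x(j := t)) = a j * t + linear_form I a x"
  by (auto simp: linear_form_def intro!: sum.cong)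

lemma integrable_linear_form_power:
  assumes "finite I"
  shows "integrable (PiM I (\<lambda>_. unif)) (\<lambda>x. linear_form I a x ^ k)"
proof -
  interpret P: prob_space "PiM I (\<lambda>_. unif)" by (intro prob_space_PiM prob_space_unif)
  have "AE x in PiM I (\<lambda>_. unif). \<forall>i\<in>I. \<bar>x i\<bar> \<le> sqrt 3"
    using assms AE_unif_bounded prob_space_unif by (intro AE_finite_allI AE_PiM_component)
  then have "AE x in PiM I (\<lambda>_. unif). norm (linear_form I a x ^ k) \<le> (\<Sum>i\<in>I. \<bar>a i\<bar> * sqrt 3) ^ k"
  proof eventually_elim
    case (elim x)
    have "\<bar>linear_form I a x\<bar> \<le> (\<Sum>i\<in>I. \<bar>a i * x i\<bar>)" unfolding linear_form_def by (rule sum_abs)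
    also have "\<dots> \<le> (\<Sum>i\<in>I. \<bar>a i\<bar> * sqrt 3)"
      using elim by (intro sum_mono) (auto simp: abs_mult intro!: mult_left_mono)
    finally show ?case by (auto simp: power_abs intro!: power_mono)
  qed
  then show ?thesis by (rule P.integrable_const_bound) measurable
qed

lemma linear_form_second_moment:
  assumes "finite I"
  shows "(\<integral>x. (linear_form I a x)\<^sup>2 \<partial>PiM I (\<lambda>_. unif)) = (\<Sum>i\<in>I. (a i)\<^sup>2)"
  using assms
proof (induction I)
  case (insert j I)
  interpret P: prob_space "PiM I (\<lambda>_. unif)" by (intro prob_space_PiM prob_space_unif)
  have "(\<integral>x. (linear_form (insert j I) a x)\<^sup>2 \<partial>PiM (insert j I) (\<lambda>_. unif))
      = (\<integral>x. \<integral>t. (a j)\<^sup>2 * t\<^sup>2 + 2 * a j * linear_form I a x * t + (linear_form I a x)\<^sup>2 \<partial>unif \<partial>PiM I (\<lambda>_. unif))"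
    using insert.hyps integrable_linear_form_power[of "insert j I" a 2]
    by (subst unifs.product_integral_insert) (auto simp: linear_form_update power2_eq_square algebra_simps)
  also have "\<dots> = (\<integral>x. (a j)\<^sup>2 + (linear_form I a x)\<^sup>2 \<partial>PiM I (\<lambda>_. unif))"
    using integrable_unif_power[of 2] integrable_unif_power[of 1] by (simp add: unif_moments)
  also have "\<dots> = (a j)\<^sup>2 + (\<Sum>i\<in>I. (a i)\<^sup>2)"
    using insert integrable_linear_form_power[of I a 2] by (simp add: P.prob_space)
  finally show ?case using insert.hyps by simp
qed (simp add: linear_form_def)

text \<open>
  The coordinates are independent and symmetric, hence only the even moments survive when one coordinate is
  integrated out; the constant \<open>3\<close> is the Gaussian one, and the coordinates themselves
  have the smaller fourth moment \<open>9/5\<close>.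
\<close>

lemma linear_form_fourth_moment:
  assumes "finite I"
  shows "(\<integral>x. (linear_form I a x) ^ 4 \<partial>PiM I (\<lambda>_. unif)) \<le> 3 * (\<Sum>i\<in>I. (a i)\<^sup>2)\<^sup>2"
  using assms
proof (induction I)
  case (insert j I)
  interpret P: prob_space "PiM I (\<lambda>_. unif)" by (intro prob_space_PiM prob_space_unif)
  have "(\<integral>x. (linear_form (insert j I) a x) ^ 4 \<partial>PiM (insert j I) (\<lambda>_. unif))
      = (\<integral>x. \<integral>t. a j ^ 4 * t ^ 4 + 4 * a j ^ 3 * linear_form I a x * t ^ 3 + 6 * (a j)\<^sup>2 * (linear_form I a x)\<^sup>2 * t\<^sup>2
          + 4 * a j * linear_form I a x ^ 3 * t + linear_form I a x ^ 4 \<partial>unif \<partial>PiM I (\<lambda>_. unif))"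
    using insert.hyps integrable_linear_form_power[of "insert j I" a 4]
    by (subst unifs.product_integral_insert) (auto simp: linear_form_update eval_nat_numeral algebra_simps)
  also have "\<dots> = (\<integral>x. a j ^ 4 * 9 / 5 + 6 * (a j)\<^sup>2 * (linear_form I a x)\<^sup>2 + linear_form I a x ^ 4 \<partial>PiM I (\<lambda>_. unif))"
    using integrable_unif_power[of 4] integrable_unif_power[of 3] integrable_unif_power[of 2] integrable_unif_power[of 1]
    by (simp add: unif_moments)
  also have "\<dots> = a j ^ 4 * 9 / 5 + 6 * (a j)\<^sup>2 * (\<Sum>i\<in>I. (a i)\<^sup>2) + (\<integral>x. linear_form I a x ^ 4 \<partial>PiM I (\<lambda>_. unif))"
    using insert.hyps integrable_linear_form_power[of I a 2] integrable_linear_form_power[of I a 4]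
    by (simp add: P.prob_space linear_form_second_moment)
  also have "\<dots> \<le> 3 * a j ^ 4 + 6 * (a j)\<^sup>2 * (\<Sum>i\<in>I. (a i)\<^sup>2) + 3 * (\<Sum>i\<in>I. (a i)\<^sup>2)\<^sup>2"
    using insert.IH by (intro add_mono) auto
  also have "\<dots> = 3 * ((a j)\<^sup>2 + (\<Sum>i\<in>I. (a i)\<^sup>2))\<^sup>2"
    by (simp add: eval_nat_numeral algebra_simps)
  finally show ?case using insert.hyps by simp
qed (simp add: linear_form_def)

definition cube :: "nat \<Rightarrow> (nat \<Rightarrow> real) measure" where
  "cube d = PiM {..<d} (\<lambda>_. unif)"

lemma prob_space_cube: "prob_space (cube d)"
  unfolding cube_def by (intro prob_space_PiM prob_space_unif)

lemma sets_cube: "sets (cube d) = sets (Rd d)"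
  unfolding cube_def Rd_def by (intro sets_PiM_cong) auto

lemma zero_mean_cube: "zero_mean d (cube d)"
  unfolding zero_mean_def
proof (intro allI impI)
  fix i assume "i < d"
  then have eq: "distr (cube d) unif (\<lambda>x. x i) = unif"
    unfolding cube_def by (intro distr_PiM_component prob_space_unif) auto
  have m[measurable]: "(\<lambda>x. x i) \<in> measurable (cube d) unif"
    using \<open>i < d\<close> unfolding cube_def by simp
  have "integrable unif (\<lambda>t. t)" using integrable_unif_power[of 1] by simp
  then have "integrable (cube d) (\<lambda>x. x i)"
    using integrable_distr[OF m, of "\<lambda>t. t"] by (simp add: eq)
  moreover have "(\<integral>x. x i \<partial>cube d) = 0"
    using integral_distr[OF m, of "\<lambda>t. t"] by (simp add: eq unif_moments)
  ultimately show "integrable (cube d) (\<lambda>x. x i) \<and> (\<integral>x. x i \<partial>cube d) = 0" ..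
qed

lemma isotropic_cube: "isotropic d (cube d)"
  unfolding isotropic_def
proof (intro allI impI)
  fix i j assume ij: "i < d" "j < d"
  define u where "u i k = (of_bool (k = i) :: real)" for i k :: nat
  have u: "linear_form {..<d} (u i) x = x i" if "i < d" for i x
  proof -
    have "linear_form {..<d} (u i) x = (\<Sum>k\<in>{i}. u i k * x k)"
      unfolding linear_form_def using that by (intro sum.mono_neutral_right) (auto simp: u_def)
    then show ?thesis by (simp add: u_def)
  qed
  have u2: "(\<Sum>k<d. (u i k)\<^sup>2) = 1" if "i < d" for i
  proof -
    have "(\<Sum>k<d. (u i k)\<^sup>2) = (\<Sum>k\<in>{i}. (u i k)\<^sup>2)"
      using that by (intro sum.mono_neutral_right) (auto simp: u_def)
    then show ?thesis by (simp add: u_def)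
  qed
  have sum: "linear_form {..<d} (\<lambda>k. u i k + u j k) x = x i + x j" for x
    using u[OF ij(1), of x] u[OF ij(2), of x] by (simp add: linear_form_def distrib_right sum.distrib)
  have sum2: "(\<Sum>k<d. (u i k + u j k)\<^sup>2) = 2 + 2 * of_bool (i = j)"
  proof -
    have "(\<Sum>k<d. (u i k + u j k)\<^sup>2) = (\<Sum>k<d. (u i k)\<^sup>2) + (\<Sum>k<d. (u j k)\<^sup>2) + (\<Sum>k<d. 2 * of_bool (i = j) * (u i k)\<^sup>2)"
      unfolding sum.distrib[symmetric] by (intro sum.cong refl) (auto simp: u_def power2_eq_square)
    then show ?thesis using ij by (simp add: u2 sum_distrib_left[symmetric])
  qed
  have int: "integrable (cube d) (\<lambda>x. (x i)\<^sup>2)" "integrable (cube d) (\<lambda>x. (x j)\<^sup>2)" "integrable (cube d) (\<lambda>x. (x i + x j)\<^sup>2)"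
    using integrable_linear_form_power[of "{..<d}" "u i" 2] integrable_linear_form_power[of "{..<d}" "u j" 2]
      integrable_linear_form_power[of "{..<d}" "\<lambda>k. u i k + u j k" 2] ij
    by (simp_all add: u sum cube_def)
  have val: "(\<integral>x. (x i)\<^sup>2 \<partial>cube d) = 1" "(\<integral>x. (x j)\<^sup>2 \<partial>cube d) = 1" "(\<integral>x. (x i + x j)\<^sup>2 \<partial>cube d) = 2 + 2 * of_bool (i = j)"
    using linear_form_second_moment[of "{..<d}" "u i"] linear_form_second_moment[of "{..<d}" "u j"]
      linear_form_second_moment[of "{..<d}" "\<lambda>k. u i k + u j k"] ij
    by (simp_all add: u u2 sum sum2 cube_def)
  \<comment> \<open>Polarisation reduces the mixed moment to second moments of linear forms.\<close>
  have polar: "(\<lambda>x. x i * x j) = (\<lambda>x::nat \<Rightarrow> real. ((x i + x j)\<^sup>2 - (x i)\<^sup>2 - (x j)\<^sup>2) / 2)"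
    by (simp add: power2_eq_square algebra_simps)
  show "integrable (cube d) (\<lambda>x. x i * x j) \<and> (\<integral>x. x i * x j \<partial>cube d) = of_bool (i = j)"
    unfolding polar using int val by auto
qed

text \<open>
  The density is a constant on a convex set and vanishes elsewhere.
\<close>

lemma log_concave_cube: "log_concave_distribution d (cube d)"
proof -
  define g where "g t = indicator {- sqrt 3..sqrt 3} t / (2 * sqrt 3)" for t :: real
  define p where "p x = (\<Prod>i<d. g (x i))" for x :: "nat \<Rightarrow> real"
  have g[measurable]: "g \<in> borel_measurable borel" unfolding g_def by measurable
  have unif: "unif = density lborel (\<lambda>t. ennreal (g t))" by (simp add: unif_def g_def)
  have dens: "cube d = density (Rd d) (\<lambda>x. ennreal (p x))"
    unfolding cube_def Rd_def p_def unif
    by (rule PiM_density)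
       (use lborel.sigma_finite_measure_axioms unif.sigma_finite_measure_axioms in \<open>auto simp: unif[symmetric], auto simp: g_def\<close>)
  have p: "p x = (if \<forall>i<d. \<bar>x i\<bar> \<le> sqrt 3 then (1 / (2 * sqrt 3)) ^ d else 0)" for x
  proof (cases "\<forall>i<d. \<bar>x i\<bar> \<le> sqrt 3")
    case True
    then have "p x = (\<Prod>i<d. 1 / (2 * sqrt 3))"
      unfolding p_def g_def by (intro prod.cong) (auto simp: indicator_def abs_le_iff minus_le_iff)
    with True show ?thesis by simp
  next
    case False
    then obtain i where "i < d" "\<not> \<bar>x i\<bar> \<le> sqrt 3" by auto
    then have "i < d" "g (x i) = 0" by (auto simp: g_def indicator_def)
    then have "p x = 0" unfolding p_def by (intro prod_zero) auto
    with False show ?thesis by simp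
  qed
  have lc: "p x powr t * p y powr (1 - t) \<le> p (\<lambda>i\<in>{..<d}. t * x i + (1 - t) * y i)"
    if t: "0 < t" "t < 1" for x y t
  proof (cases "(\<forall>i<d. \<bar>x i\<bar> \<le> sqrt 3) \<and> (\<forall>i<d. \<bar>y i\<bar> \<le> sqrt 3)")
    case True
    have "\<bar>t * x i + (1 - t) * y i\<bar> \<le> sqrt 3" if "i < d" for i
    proof -
      have "\<bar>t * x i + (1 - t) * y i\<bar> \<le> t * \<bar>x i\<bar> + (1 - t) * \<bar>y i\<bar>"
        using t abs_triangle_ineq[of "t * x i" "(1 - t) * y i"] by (simp add: abs_mult)
      also have "\<dots> \<le> t * sqrt 3 + (1 - t) * sqrt 3"
        using True t that by (intro add_mono mult_left_mono) auto
      finally show ?thesis by (simp add: algebra_simps)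
    qed
    moreover have "((1 / (2 * sqrt 3)) ^ d) powr t * ((1 / (2 * sqrt 3)) ^ d) powr (1 - t) = (1 / (2 * sqrt 3)) ^ d"
      by (simp add: powr_add[symmetric])
    ultimately show ?thesis using True by (simp add: p)
  next
    case False
    then have "p x powr t * p y powr (1 - t) = 0" by (auto simp: p)
    moreover have "0 \<le> p z" for z by (simp add: p)
    ultimately show ?thesis by (simp only:)
  qed
  have [measurable]: "p \<in> borel_measurable (Rd d)"
    unfolding p_def[abs_def] Rd_def by measurable
  show ?thesis
    unfolding log_concave_distribution_def
    using dens lc by (intro bexI[of _ p]) (auto simp: p)
qed

section \<open>Tilted halfspaces and their distances\<close>

text \<open>
  The normal vectors are close to the zeroth unit vector, so that the decision depends on whether \<open>x 0\<close>
  exceeds a small linear form in the remaining, independent coordinates.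
\<close>

definition tilt :: "real \<Rightarrow> nat set \<Rightarrow> nat \<Rightarrow> real" where
  "tilt \<epsilon> T i = (if i = 0 then 1 else if i \<in> T then \<epsilon> else - \<epsilon>)"

abbreviation tilted_halfspace :: "nat \<Rightarrow> real \<Rightarrow> nat set \<Rightarrow> (nat \<Rightarrow> real) \<Rightarrow> int" where
  "tilted_halfspace d \<epsilon> T \<equiv> halfspace_classifier d (tilt \<epsilon> T)"

lemma tilted_halfspace_eq:
  assumes "1 \<le> d"
  shows "tilted_halfspace d \<epsilon> T x = (if x 0 + linear_form {1..<d} (tilt \<epsilon> T) x \<ge> 0 then 1 else -1)"
proof -
  have "{..<d} = insert 0 {1..<d}" using assms by auto
  then have "(\<Sum>i<d. tilt \<epsilon> T i * x i) = x 0 + linear_form {1..<d} (tilt \<epsilon> T) x"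
    by (simp add: linear_form_def tilt_def)
  then show ?thesis by (simp add: halfspace_classifier_def)
qed

lemma linear_form_update_other: "0 \<notin> I \<Longrightarrow> linear_form I a (x(0 := t)) = linear_form I a x"
  by (auto simp: linear_form_def intro!: sum.cong)

lemma nn_integral_cube:
  assumes d: "1 \<le> d" and f: "f \<in> borel_measurable (cube d)"
  shows "(\<integral>\<^sup>+x. f x \<partial>cube d) = (\<integral>\<^sup>+x. \<integral>\<^sup>+t. f (x(0 := t)) \<partial>unif \<partial>PiM {1..<d} (\<lambda>_. unif))"
proof -
  have "{..<d} = insert 0 {1..<d}" using d by auto
  then show ?thesis
    using f unfolding cube_def by (simp add: unifs.product_nn_integral_insert)
qed

lemma sum_tilt_squared: "(\<Sum>i\<in>{1..<d}. (tilt \<epsilon> T i)\<^sup>2) = \<epsilon>\<^sup>2 * real (d - 1)"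
proof -
  have "(\<Sum>i\<in>{1..<d}. (tilt \<epsilon> T i)\<^sup>2) = (\<Sum>i\<in>{1..<d}. \<epsilon>\<^sup>2)"
    by (intro sum.cong) (auto simp: tilt_def)
  then show ?thesis by simp
qed

lemma measurable_halfspace[measurable]: "halfspace_classifier d w \<in> measurable (cube d) fair_sign"
proof -
  have [measurable]: "(\<lambda>x. \<Sum>i<d. w i * x i) \<in> borel_measurable (cube d)"
    unfolding cube_def by measurable
  have "halfspace_classifier d w \<in> measurable (cube d) (count_space {1, -1})"
    unfolding halfspace_classifier_def[abs_def] by measurable
  then show ?thesis
    using measurable_cong_sets[OF refl sets_uniform_count_measure_count_space] by blast
qed

text \<open>
  With the other coordinates fixed, two targets disagree when \<open>x 0\<close> lies between two thresholds. The factor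
  \<open>1 - (a\<^sup>2 + b\<^sup>2) / 3\<close> accounts for clipping: it is at most \<open>0\<close> when a threshold leaves
  \<open>[- sqrt 3, sqrt 3]\<close>, and at most \<open>1\<close> always.
\<close>

lemma unif_disagreement:
  "ennreal (\<bar>a - b\<bar> * (1 - (a\<^sup>2 + b\<^sup>2) / 3) / (2 * sqrt 3)) \<le> emeasure unif {t. (t + a \<ge> 0) \<noteq> (t + b \<ge> 0)}"
proof (induction a b rule: linorder_wlog)
  case (sym a b)
  have "{t. (t + a \<ge> 0) \<noteq> (t + b \<ge> 0)} = {t. (t + b \<ge> 0) \<noteq> (t + a \<ge> 0)}" by auto
  with sym show ?case by (simp add: abs_minus_commute add.commute[of "a\<^sup>2"])
next
  case (le a b)
  have eq: "{t. (t + a \<ge> 0) \<noteq> (t + b \<ge> 0)} = {- b..<- a}" using le by auto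
  show ?case
  proof (cases "\<bar>a\<bar> \<le> sqrt 3 \<and> \<bar>b\<bar> \<le> sqrt 3")
    case True
    have "emeasure unif {- b..<- a} = (\<integral>\<^sup>+t. indicator {- b..<- a} t \<partial>unif)" by simp
    also have "\<dots> = ennreal (1 / (2 * sqrt 3)) * (\<integral>\<^sup>+t. indicator {- b..<- a} t * indicator {- sqrt 3..sqrt 3} t \<partial>lborel)"
      by (rule nn_integral_unif) simp
    also have "(\<integral>\<^sup>+t. indicator {- b..<- a} t * indicator {- sqrt 3..sqrt 3} t \<partial>lborel) = (\<integral>\<^sup>+t. indicator {- b..<- a} t \<partial>lborel)"
      using True by (intro nn_integral_cong) (auto simp: indicator_def)
    also have "\<dots> = ennreal (b - a)" using le by simp
    also have "ennreal (1 / (2 * sqrt 3)) * ennreal (b - a) = ennreal ((b - a) / (2 * sqrt 3))"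
      using le by (simp add: ennreal_mult[symmetric])
    finally have "emeasure unif {- b..<- a} = ennreal ((b - a) / (2 * sqrt 3))" .
    moreover have "\<bar>a - b\<bar> * (1 - (a\<^sup>2 + b\<^sup>2) / 3) / (2 * sqrt 3) \<le> (b - a) / (2 * sqrt 3)"
      using le by (intro divide_right_mono) (auto intro!: mult_left_le)
    ultimately show ?thesis unfolding eq by (simp add: ennreal_leI)
  next
    case False
    then consider "sqrt 3 < \<bar>a\<bar>" | "sqrt 3 < \<bar>b\<bar>" by linarith
    then have "sqrt 3 ^ 2 < \<bar>a\<bar> ^ 2 \<or> sqrt 3 ^ 2 < \<bar>b\<bar> ^ 2"
      by cases (metis power_strict_mono real_sqrt_ge_zero zero_le_numeral zero_less_numeral)+
    then have "3 < a\<^sup>2 \<or> 3 < b\<^sup>2" by simp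
    then have "3 \<le> a\<^sup>2 + b\<^sup>2"
    proof
      assume "3 < a\<^sup>2"
      then show ?thesis using zero_le_power2[of b] by linarith
    next
      assume "3 < b\<^sup>2"
      then show ?thesis using zero_le_power2[of a] by linarith
    qed
    then have "1 - (a\<^sup>2 + b\<^sup>2) / 3 \<le> 0" by simp
    then have "\<bar>a - b\<bar> * (1 - (a\<^sup>2 + b\<^sup>2) / 3) / (2 * sqrt 3) \<le> 0"
      by (auto intro!: divide_nonpos_pos mult_nonneg_nonpos)
    then show ?thesis by (simp add: ennreal_neg)
  qed
qed

text \<open>
  The expectation of \<open>\<bar>D\<bar>\<close> is bounded from below by second and fourth moments only: \<open>u \<ge> u\<^sup>2 - u ^ 4 / 4\<close>
  for \<open>u \<ge> 0\<close>, scaled to the size \<open>w\<close> of \<open>D\<close>. The clipping term is split by Young's inequality with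
  weight \<open>10 * w\<close>, which leaves a small multiple of \<open>D\<^sup>2 / w\<close> and fourth powers of the thresholds.
\<close>

lemma disagreement_polynomial_bound:
  fixes a b w :: real
  assumes "0 < w"
  defines "D \<equiv> a - b"
  shows "29 / 60 * D\<^sup>2 / w - D ^ 4 / (32 * w ^ 3) - 10 * w * (a ^ 4 + b ^ 4) / 3 \<le> \<bar>D\<bar> * (1 - (a\<^sup>2 + b\<^sup>2) / 3)"
proof -
  define u where "u = \<bar>D\<bar> / (2 * w)"
  have u: "0 \<le> u" and Dw: "\<bar>D\<bar> = 2 * w * u" using assms by (auto simp: u_def)
  have D2: "D\<^sup>2 = 4 * w\<^sup>2 * u\<^sup>2" and D4: "D ^ 4 = 16 * w ^ 4 * u ^ 4"
  proof -
    have "D\<^sup>2 = \<bar>D\<bar>\<^sup>2" by simp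
    then show *: "D\<^sup>2 = 4 * w\<^sup>2 * u\<^sup>2" unfolding Dw by (simp add: power_mult_distrib)
    have "D ^ 4 = (D\<^sup>2)\<^sup>2" by (simp add: power_mult[symmetric])
    then show "D ^ 4 = 16 * w ^ 4 * u ^ 4" unfolding * by (simp add: power_mult_distrib power_mult[symmetric])
  qed
  have "u - u ^ 3 / 4 \<le> 1"
  proof -
    have "0 \<le> (u - 1)\<^sup>2 * (u + 2)" using u by simp
    moreover have "(u - 1)\<^sup>2 * (u + 2) = u ^ 3 - 3 * u + 2" by (simp add: eval_nat_numeral algebra_simps)
    ultimately have "3 * u \<le> u ^ 3 + 2" by simp
    moreover have "u ^ 3 \<ge> 0" using u by simp
    ultimately show ?thesis
      using u by sos
  qed
  then have "(2 * w * u) * (u - u ^ 3 / 4) \<le> (2 * w * u) * 1"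
    using u \<open>0 < w\<close> by (intro mult_left_mono) auto
  then have 1: "2 * w * (u\<^sup>2 - u ^ 4 / 4) \<le> \<bar>D\<bar>"
    unfolding Dw by (simp add: algebra_simps eval_nat_numeral)
  have "0 \<le> (\<bar>D\<bar> - 10 * w * (a\<^sup>2 + b\<^sup>2))\<^sup>2 / (20 * w)" using \<open>0 < w\<close> by simp
  also have "\<dots> = D\<^sup>2 / (20 * w) + 5 * w * (a\<^sup>2 + b\<^sup>2)\<^sup>2 - \<bar>D\<bar> * (a\<^sup>2 + b\<^sup>2)"
    using \<open>0 < w\<close> by (simp add: power2_diff field_simps) (simp add: power2_eq_square algebra_simps)
  finally have "\<bar>D\<bar> * (a\<^sup>2 + b\<^sup>2) \<le> D\<^sup>2 / (20 * w) + 5 * w * (a\<^sup>2 + b\<^sup>2)\<^sup>2" by simp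
  also have "\<dots> \<le> D\<^sup>2 / (20 * w) + 5 * w * (2 * (a ^ 4 + b ^ 4))"
  proof -
    have "0 \<le> (a\<^sup>2 - b\<^sup>2)\<^sup>2" by simp
    then have "(a\<^sup>2 + b\<^sup>2)\<^sup>2 \<le> 2 * (a ^ 4 + b ^ 4)" by (simp add: eval_nat_numeral algebra_simps)
    then show ?thesis using \<open>0 < w\<close> by (intro add_left_mono mult_left_mono) auto
  qed
  also have "\<dots> = 3 * (D\<^sup>2 / (60 * w) + 10 * w * (a ^ 4 + b ^ 4) / 3)"
    using \<open>0 < w\<close> by (simp add: field_simps)
  finally have "\<bar>D\<bar> * (a\<^sup>2 + b\<^sup>2) \<le> 3 * (D\<^sup>2 / (60 * w) + 10 * w * (a ^ 4 + b ^ 4) / 3)" .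
  moreover have "x / 3 \<le> y" if "x \<le> 3 * y" for x y :: real using that by simp
  ultimately have 2: "\<bar>D\<bar> * (a\<^sup>2 + b\<^sup>2) / 3 \<le> D\<^sup>2 / (60 * w) + 10 * w * (a ^ 4 + b ^ 4) / 3"
    by blast
  have "29 / 60 * D\<^sup>2 / w - D ^ 4 / (32 * w ^ 3) - 10 * w * (a ^ 4 + b ^ 4) / 3
      = 2 * w * (u\<^sup>2 - u ^ 4 / 4) - (D\<^sup>2 / (60 * w) + 10 * w * (a ^ 4 + b ^ 4) / 3)"
    unfolding D2 D4 using \<open>0 < w\<close> by (simp add: field_simps eval_nat_numeral)
  also have "\<dots> \<le> \<bar>D\<bar> - \<bar>D\<bar> * (a\<^sup>2 + b\<^sup>2) / 3" using 1 2 by (rule diff_mono)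
  finally show ?thesis by (simp add: algebra_simps)
qed

lemma ennreal_integral_le_nn_integral:
  fixes Q :: "'a \<Rightarrow> real"
  assumes "integrable M Q"
  shows "ennreal (\<integral>x. Q x \<partial>M) \<le> (\<integral>\<^sup>+x. ennreal (Q x) \<partial>M)"
proof -
  have int: "integrable M (\<lambda>x. max 0 (Q x))" using assms by auto
  have "ennreal (\<integral>x. Q x \<partial>M) \<le> ennreal (\<integral>x. max 0 (Q x) \<partial>M)"
    using assms int by (intro ennreal_leI integral_mono) auto
  also have "\<dots> = (\<integral>\<^sup>+x. ennreal (max 0 (Q x)) \<partial>M)"
    using int by (intro nn_integral_eq_integral[symmetric]) auto
  also have "\<dots> = (\<integral>\<^sup>+x. ennreal (Q x) \<partial>M)"
    by (intro nn_integral_cong) (simp add: ennreal_max_0)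
  finally show ?thesis .
qed

text \<open>
  The difference of the two thresholds is a linear form with \<open>k = card (sym_diff T T')\<close> coefficients
  \<open>\<plusminus> 2 * \<epsilon>\<close>, hence of standard deviation \<open>w = 2 * \<epsilon> * sqrt k\<close>; as its fourth moment is at most \<open>3 * w ^ 4\<close>,
  its mean absolute value has the same order \<open>w\<close>. The bound on \<open>\<epsilon>\<close> keeps the thresholds small enough
  for clipping to be negligible.
\<close>

lemma tilted_halfspaces_separated:
  assumes d: "1 \<le> d" and \<epsilon>: "0 < \<epsilon>" "\<epsilon>\<^sup>2 * real (d - 1) \<le> 1 / 1600"
    and T: "T \<subseteq> {1..<d}" "T' \<subseteq> {1..<d}"
  shows "\<epsilon> * sqrt (real (card (sym_diff T T'))) / 8
    \<le> measure (cube d) {x \<in> space (cube d). tilted_halfspace d \<epsilon> T x \<noteq> tilted_halfspace d \<epsilon> T' x}"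
proof (cases "card (sym_diff T T') = 0")
  case False
  define I where "I = {1..<d}"
  define k where "k = real (card (sym_diff T T'))"
  define M where "M = PiM I (\<lambda>_. unif)"
  define a where "a x = linear_form I (tilt \<epsilon> T) x" for x
  define b where "b x = linear_form I (tilt \<epsilon> T') x" for x
  define w where "w = 2 * \<epsilon> * sqrt k"
  have k: "1 \<le> k" using False by (simp add: k_def)
  have w: "0 < w" using \<epsilon> k by (simp add: w_def)
  have w2: "w\<^sup>2 = 4 * \<epsilon>\<^sup>2 * k" using k by (simp add: w_def power_mult_distrib)
  have I: "finite I" "0 \<notin> I" by (auto simp: I_def)
  interpret M: prob_space M unfolding M_def by (intro prob_space_PiM prob_space_unif)
  interpret C: prob_space "cube d" by (rule prob_space_cube)
  have D: "a x - b x = linear_form I (\<lambda>i. tilt \<epsilon> T i - tilt \<epsilon> T' i) x" for x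
    by (simp add: a_def b_def linear_form_def sum_subtractf left_diff_distrib)
  have D2: "(\<Sum>i\<in>I. (tilt \<epsilon> T i - tilt \<epsilon> T' i)\<^sup>2) = w\<^sup>2"
  proof -
    have "(\<Sum>i\<in>I. (tilt \<epsilon> T i - tilt \<epsilon> T' i)\<^sup>2) = (\<Sum>i\<in>sym_diff T T'. 4 * \<epsilon>\<^sup>2)"
    proof (rule sum.mono_neutral_cong_right)
      show "sym_diff T T' \<subseteq> I" using T by (auto simp: I_def)
    qed (use I T in \<open>auto simp: tilt_def I_def power_mult_distrib\<close>)
    then show ?thesis by (simp add: w2 k_def)
  qed
  have moments:
    "integrable M (\<lambda>x. (a x - b x)\<^sup>2)" "integrable M (\<lambda>x. (a x - b x) ^ 4)" "integrable M (\<lambda>x. a x ^ 4)" "integrable M (\<lambda>x. b x ^ 4)"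
    "(\<integral>x. (a x - b x)\<^sup>2 \<partial>M) = w\<^sup>2" "(\<integral>x. (a x - b x) ^ 4 \<partial>M) \<le> 3 * w ^ 4"
    "(\<integral>x. a x ^ 4 \<partial>M) \<le> 3 * (1 / 1600)\<^sup>2" "(\<integral>x. b x ^ 4 \<partial>M) \<le> 3 * (1 / 1600)\<^sup>2"
  proof -
    show "integrable M (\<lambda>x. (a x - b x)\<^sup>2)" "integrable M (\<lambda>x. (a x - b x) ^ 4)"
      unfolding D M_def using I by (intro integrable_linear_form_power; simp)+
    show "integrable M (\<lambda>x. a x ^ 4)" "integrable M (\<lambda>x. b x ^ 4)"
      unfolding a_def b_def M_def using I by (intro integrable_linear_form_power; simp)+
    show "(\<integral>x. (a x - b x)\<^sup>2 \<partial>M) = w\<^sup>2"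
      unfolding D M_def linear_form_second_moment[OF I(1)] D2 ..
    show "(\<integral>x. (a x - b x) ^ 4 \<partial>M) \<le> 3 * w ^ 4"
      using linear_form_fourth_moment[OF I(1), of "\<lambda>i. tilt \<epsilon> T i - tilt \<epsilon> T' i"]
      unfolding D M_def D2 by (simp add: power_mult[symmetric])
    have bound: "3 * (\<epsilon>\<^sup>2 * real (d - 1))\<^sup>2 \<le> 3 * (1 / 1600)\<^sup>2"
      using \<epsilon> by (intro mult_left_mono power_mono) auto
    show "(\<integral>x. a x ^ 4 \<partial>M) \<le> 3 * (1 / 1600)\<^sup>2" "(\<integral>x. b x ^ 4 \<partial>M) \<le> 3 * (1 / 1600)\<^sup>2"
      using linear_form_fourth_moment[OF I(1), of "tilt \<epsilon> T"] linear_form_fourth_moment[OF I(1), of "tilt \<epsilon> T'"] bound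
      unfolding a_def b_def M_def I_def sum_tilt_squared by linarith+
  qed
  define Q where "Q x = (29 / 60 * (a x - b x)\<^sup>2 / w - (a x - b x) ^ 4 / (32 * w ^ 3)
    - 10 * w * (a x ^ 4 + b x ^ 4) / 3) / (2 * sqrt 3)" for x
  have Q: "integrable M Q" unfolding Q_def[abs_def] using moments by auto
  have "(\<integral>x. Q x \<partial>M) = (29 / 60 * w\<^sup>2 / w - (\<integral>x. (a x - b x) ^ 4 \<partial>M) / (32 * w ^ 3)
    - 10 * w * ((\<integral>x. a x ^ 4 \<partial>M) + (\<integral>x. b x ^ 4 \<partial>M)) / 3) / (2 * sqrt 3)"
    unfolding Q_def using moments(1-5) by simp
  also have "\<dots> \<ge> (29 / 60 * w\<^sup>2 / w - (3 * w ^ 4) / (32 * w ^ 3)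
    - 10 * w * (3 * (1 / 1600)\<^sup>2 + 3 * (1 / 1600)\<^sup>2) / 3) / (2 * sqrt 3)"
    using moments(6-8) w by (intro divide_right_mono diff_mono mult_left_mono add_mono) auto
  also have "(29 / 60 * w\<^sup>2 / w - (3 * w ^ 4) / (32 * w ^ 3)
    - 10 * w * (3 * (1 / 1600)\<^sup>2 + 3 * (1 / 1600)\<^sup>2) / 3) / (2 * sqrt 3)
    = w * (29 / 60 - 3 / 32 - 20 * (1 / 1600)\<^sup>2) / (2 * sqrt 3)"
    using w by (simp add: field_simps eval_nat_numeral)
  also have "w * (29 / 60 - 3 / 32 - 20 * (1 / 1600)\<^sup>2) / (2 * sqrt 3) \<ge> w * (1 / 4) / (2 * 2)"
    using w real_sqrt_le_iff[of 3 4] by (intro frac_le mult_left_mono) (auto simp: power2_eq_square)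
  finally have EQ: "\<epsilon> * sqrt k / 8 \<le> (\<integral>x. Q x \<partial>M)" by (simp add: w_def)
  let ?S = "{x \<in> space (cube d). tilted_halfspace d \<epsilon> T x \<noteq> tilted_halfspace d \<epsilon> T' x}"
  have S: "?S \<in> sets (cube d)"
    using measurable_disagree[OF measurable_halfspace measurable_halfspace] by simp
  have "ennreal (\<epsilon> * sqrt k / 8) \<le> ennreal (\<integral>x. Q x \<partial>M)" using EQ by (rule ennreal_leI)
  also have "\<dots> \<le> (\<integral>\<^sup>+x. ennreal (Q x) \<partial>M)" by (rule ennreal_integral_le_nn_integral[OF Q])
  also have "\<dots> \<le> (\<integral>\<^sup>+x. \<integral>\<^sup>+t. indicator ?S (x(0 := t)) \<partial>unif \<partial>M)"
  proof (rule nn_integral_mono)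
    fix x assume x: "x \<in> space M"
    have "ennreal (Q x) \<le> ennreal (\<bar>a x - b x\<bar> * (1 - ((a x)\<^sup>2 + (b x)\<^sup>2) / 3) / (2 * sqrt 3))"
      unfolding Q_def using disagreement_polynomial_bound[OF w, of "a x" "b x"]
      by (intro ennreal_leI divide_right_mono) auto
    also have "\<dots> \<le> emeasure unif {t. (t + a x \<ge> 0) \<noteq> (t + b x \<ge> 0)}" by (rule unif_disagreement)
    also have "\<dots> = (\<integral>\<^sup>+t. indicator {t. (t + a x \<ge> 0) \<noteq> (t + b x \<ge> 0)} t \<partial>unif)" by simp
    also have "\<dots> = (\<integral>\<^sup>+t. indicator ?S (x(0 := t)) \<partial>unif)"
    proof (rule nn_integral_cong)
      fix t :: real
      have "x(0 := t) \<in> space (cube d)"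
        using x d by (auto simp: M_def cube_def space_PiM PiE_iff I_def extensional_def)
      then show "indicator {t. (t + a x \<ge> 0) \<noteq> (t + b x \<ge> 0)} t = (indicator ?S (x(0 := t)) :: ennreal)"
        using d I by (auto simp: indicator_def tilted_halfspace_eq linear_form_update_other a_def b_def I_def split: if_splits)
    qed
    finally show "ennreal (Q x) \<le> (\<integral>\<^sup>+t. indicator ?S (x(0 := t)) \<partial>unif)" .
  qed
  also have "\<dots> = emeasure (cube d) ?S"
    using S nn_integral_cube[OF d, of "indicator ?S"] by (simp add: M_def I_def)
  finally show ?thesis
    unfolding C.emeasure_eq_measure k_def[symmetric] by simp
qed simp

section \<open>Chi-square distance to the blurred halfspace\<close>

text \<open>
  The second moment of the likelihood ratio of two \<open>\<plusminus> 1\<close> variables with means \<open>\<eta>\<close> and \<open>\<eta>'\<close>.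
\<close>

lemma two_point_chi_square:
  fixes \<eta> \<eta>' :: real
  assumes "\<bar>\<eta>'\<bar> < 1"
  shows "((1 + \<eta>)\<^sup>2 / (1 + \<eta>') + (1 - \<eta>)\<^sup>2 / (1 - \<eta>')) / 2 = 1 + (\<eta> - \<eta>')\<^sup>2 / (1 - \<eta>'\<^sup>2)"
proof -
  have nz: "1 + \<eta>' \<noteq> 0" "1 - \<eta>' \<noteq> 0" using assms by auto
  have "1 - \<eta>'\<^sup>2 = (1 + \<eta>') * (1 - \<eta>')" by (simp add: power2_eq_square algebra_simps)
  then show ?thesis using nz by (simp add: divide_simps) (simp add: power2_eq_square algebra_simps)
qed

text \<open>
  The cost of replacing the mean \<open>h\<close> by \<open>h * m\<close> or by \<open>- h * m\<close>. Both bounds hold uniformly up to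
  \<open>h = 1\<close>, because \<open>(h * m)\<^sup>2 \<le> m\<^sup>2\<close> keeps the denominator at least \<open>1 - m\<^sup>2\<close>.
\<close>

lemma blurred_bias_chi_square:
  fixes h m :: real
  assumes h: "0 \<le> h" "h \<le> 1" and m: "0 \<le> m" "m < 1"
  shows "(h - h * m)\<^sup>2 / (1 - (h * m)\<^sup>2) \<le> h\<^sup>2 * (1 - m)"
    and "(h + h * m)\<^sup>2 / (1 - (h * m)\<^sup>2) \<le> h\<^sup>2 * (2 / (1 - m))"
proof -
  have hm: "(h * m)\<^sup>2 \<le> m\<^sup>2" using h m by (intro power_mono mult_left_le_one_le) auto
  have mm: "m\<^sup>2 \<le> m" "m\<^sup>2 < 1" using m by (auto simp: power2_eq_square mult_left_le abs_square_less_1[unfolded power2_eq_square])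
  have pos: "0 < 1 - (h * m)\<^sup>2" using hm mm by linarith
  have "(h - h * m)\<^sup>2 = h\<^sup>2 * (1 - m) * (1 - m)" by (simp add: power2_eq_square algebra_simps)
  also have "\<dots> \<le> h\<^sup>2 * (1 - m) * (1 - (h * m)\<^sup>2)"
    using m hm mm by (intro mult_left_mono) auto
  finally show "(h - h * m)\<^sup>2 / (1 - (h * m)\<^sup>2) \<le> h\<^sup>2 * (1 - m)"
    using pos by (simp add: divide_le_eq)
  have "(1 + m) * (1 - m\<^sup>2) \<le> 2 * (1 - (h * m)\<^sup>2)"
    using m hm mm by (intro mult_mono) auto
  then have "h\<^sup>2 * ((1 + m) * (1 - m\<^sup>2)) \<le> h\<^sup>2 * (2 * (1 - (h * m)\<^sup>2))"
    by (intro mult_left_mono) auto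
  moreover have "(h + h * m)\<^sup>2 * (1 - m) = h\<^sup>2 * ((1 + m) * (1 - m\<^sup>2))"
    by (simp add: power2_eq_square algebra_simps)
  ultimately have "(h + h * m)\<^sup>2 * (1 - m) \<le> h\<^sup>2 * (2 * (1 - (h * m)\<^sup>2))" by (simp only:)
  then have "(h + h * m)\<^sup>2 \<le> h\<^sup>2 * (2 * (1 - (h * m)\<^sup>2)) / (1 - m)"
    using m by (subst pos_le_divide_eq) auto
  also have "\<dots> = h\<^sup>2 * (2 / (1 - m)) * (1 - (h * m)\<^sup>2)" by (simp only: times_divide_eq_left times_divide_eq_right mult.assoc)
  finally show "(h + h * m)\<^sup>2 / (1 - (h * m)\<^sup>2) \<le> h\<^sup>2 * (2 / (1 - m))"
    unfolding pos_divide_le_eq[OF pos] .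
qed

lemma nn_integral_unif_le:
  assumes [measurable]: "f \<in> borel_measurable borel"
  shows "(\<integral>\<^sup>+t. f t \<partial>unif) \<le> ennreal (1 / 3) * (\<integral>\<^sup>+t. f t * indicator {- sqrt 3..sqrt 3} t \<partial>lborel)"
proof -
  have "3 / 2 \<le> sqrt 3" by (rule real_le_rsqrt) (simp add: power2_eq_square)
  then have "1 / (2 * sqrt 3) \<le> 1 / 3" by (intro frac_le) auto
  then show ?thesis
    by (subst nn_integral_unif) (auto intro!: mult_right_mono ennreal_leI)
qed

lemma unif_blur:
  assumes \<rho>: "0 < \<rho>"
  shows "(\<integral>\<^sup>+t. ennreal (\<rho>\<^sup>2 / (\<rho>\<^sup>2 + t\<^sup>2)) \<partial>unif) \<le> ennreal (4 / 3 * \<rho>)"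
proof -
  have pos: "0 < \<rho>\<^sup>2 + t\<^sup>2" for t using \<rho> by (simp add: add_pos_nonneg)
  have "(\<integral>\<^sup>+t. ennreal (\<rho>\<^sup>2 / (\<rho>\<^sup>2 + t\<^sup>2)) \<partial>unif)
     \<le> ennreal (1 / 3) * (\<integral>\<^sup>+t. ennreal (\<rho>\<^sup>2 / (\<rho>\<^sup>2 + t\<^sup>2)) * indicator {- sqrt 3..sqrt 3} t \<partial>lborel)"
    by (rule nn_integral_unif_le) measurable
  also have "(\<integral>\<^sup>+t. ennreal (\<rho>\<^sup>2 / (\<rho>\<^sup>2 + t\<^sup>2)) * indicator {- sqrt 3..sqrt 3} t \<partial>lborel)
     = ennreal (\<rho> * arctan (sqrt 3 / \<rho>) - \<rho> * arctan (- sqrt 3 / \<rho>))"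
  proof (rule nn_integral_FTC_Icc)
    fix t
    have "1 + (t / \<rho>)\<^sup>2 \<noteq> 0" by (simp add: add_nonneg_eq_0_iff)
    then show "((\<lambda>t. \<rho> * arctan (t / \<rho>)) has_real_derivative \<rho>\<^sup>2 / (\<rho>\<^sup>2 + t\<^sup>2)) (at t)"
      using \<rho> pos[of t] by (auto intro!: derivative_eq_intros simp: divide_simps power2_eq_square)
  qed (use \<rho> in auto)
  also have "ennreal (1 / 3) * ennreal (\<rho> * arctan (sqrt 3 / \<rho>) - \<rho> * arctan (- sqrt 3 / \<rho>))
     = ennreal (\<rho> / 3 * (2 * arctan (sqrt 3 / \<rho>)))"
    using \<rho> by (subst ennreal_mult[symmetric]) (auto simp: arctan_minus minus_divide_left[symmetric])
  also have "\<dots> \<le> ennreal (\<rho> / 3 * 4)"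
    using \<rho> arctan_ubound[of "sqrt 3 / \<rho>"] pi_less_4 by (intro ennreal_leI mult_left_mono) auto
  finally show ?thesis by (simp add: mult.commute)
qed

text \<open>
  The exact value is a cubic polynomial in \<open>z\<close>; odd powers are traded for even ones by
  \<open>2 * z * \<rho> \<le> z\<^sup>2 + \<rho>\<^sup>2\<close>, since the integration over the other coordinates provides only even moments of \<open>z\<close>.
\<close>

lemma unif_blur_inverse:
  assumes \<rho>: "0 < \<rho>" and z: "0 \<le> z"
  shows "(\<integral>\<^sup>+t. ennreal (2 * (1 + t\<^sup>2 / \<rho>\<^sup>2)) * indicator {- z..z} t \<partial>unif)
    \<le> ennreal (2 / 3 * \<rho> + 8 / 9 * (z\<^sup>2 / \<rho>) + 2 / 9 * (z ^ 4 / \<rho> ^ 3))"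
proof -
  have "(\<integral>\<^sup>+t. ennreal (2 * (1 + t\<^sup>2 / \<rho>\<^sup>2)) * indicator {- z..z} t \<partial>unif)
     \<le> ennreal (1 / 3) * (\<integral>\<^sup>+t. (ennreal (2 * (1 + t\<^sup>2 / \<rho>\<^sup>2)) * indicator {- z..z} t) * indicator {- sqrt 3..sqrt 3} t \<partial>lborel)"
    by (rule nn_integral_unif_le) measurable
  also have "\<dots> \<le> ennreal (1 / 3) * (\<integral>\<^sup>+t. ennreal (2 * (1 + t\<^sup>2 / \<rho>\<^sup>2)) * indicator {- z..z} t \<partial>lborel)"
    by (intro mult_left_mono nn_integral_mono) (auto simp: indicator_def)
  also have "(\<integral>\<^sup>+t. ennreal (2 * (1 + t\<^sup>2 / \<rho>\<^sup>2)) * indicator {- z..z} t \<partial>lborel)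
     = ennreal ((2 * z + 2 * z ^ 3 / (3 * \<rho>\<^sup>2)) - (2 * (- z) + 2 * (- z) ^ 3 / (3 * \<rho>\<^sup>2)))"
    using \<rho> z
    by (intro nn_integral_FTC_Icc) (auto intro!: derivative_eq_intros simp: divide_simps, auto simp: algebra_simps eval_nat_numeral)
  also have "ennreal (1 / 3) * \<dots> = ennreal (4 / 3 * z + 4 / 9 * (z ^ 3 / \<rho>\<^sup>2))"
    using z by (subst ennreal_mult[symmetric]) (auto intro!: arg_cong[where f = ennreal] simp: add_divide_distrib simp del: ennreal_plus)
  also have "\<dots> \<le> ennreal (2 / 3 * \<rho> + 8 / 9 * (z\<^sup>2 / \<rho>) + 2 / 9 * (z ^ 4 / \<rho> ^ 3))"
  proof (rule ennreal_leI)
    have "0 \<le> 2 / 3 * ((z - \<rho>)\<^sup>2 / \<rho>) + 2 / 9 * (z\<^sup>2 * (z - \<rho>)\<^sup>2 / \<rho> ^ 3)"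
      using \<rho> by (intro add_nonneg_nonneg) auto
    also have "\<dots> = 2 / 3 * \<rho> + 8 / 9 * (z\<^sup>2 / \<rho>) + 2 / 9 * (z ^ 4 / \<rho> ^ 3) - (4 / 3 * z + 4 / 9 * (z ^ 3 / \<rho>\<^sup>2))"
      using \<rho> by (simp add: divide_simps) (simp add: eval_nat_numeral algebra_simps)
    finally show "4 / 3 * z + 4 / 9 * (z ^ 3 / \<rho>\<^sup>2) \<le> 2 / 3 * \<rho> + 8 / 9 * (z\<^sup>2 / \<rho>) + 2 / 9 * (z ^ 4 / \<rho> ^ 3)"
      by simp
  qed
  finally show ?thesis .
qed

text \<open>
  The factor is \<open>1 - r\<close> with the Cauchy kernel \<open>r = \<rho>\<^sup>2 / (\<rho>\<^sup>2 + t\<^sup>2)\<close>: \<open>r\<close> is integrable at scale \<open>\<rho>\<close>,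
  and \<open>1 / r\<close> is a quadratic polynomial, so that no moment beyond the fourth is needed later.
\<close>

definition blurred_sign :: "real \<Rightarrow> real \<Rightarrow> real" where
  "blurred_sign \<rho> t = (if 0 \<le> t then 1 else -1) * (t\<^sup>2 / (\<rho>\<^sup>2 + t\<^sup>2))"

lemma blurred_sign_measurable[measurable]: "blurred_sign \<rho> \<in> borel_measurable borel"
  unfolding blurred_sign_def[abs_def] by measurable

lemma blurred_sign_less_1: "0 < \<rho> \<Longrightarrow> \<bar>blurred_sign \<rho> t\<bar> < 1"
  by (auto simp: blurred_sign_def abs_mult add_pos_nonneg)

lemma bias_blurred_sign_less_1: "0 < \<rho> \<Longrightarrow> 0 \<le> h \<Longrightarrow> h \<le> 1 \<Longrightarrow> \<bar>h * blurred_sign \<rho> t\<bar> < 1"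
  using blurred_sign_less_1[of \<rho> t] mult_left_le_one_le[of "\<bar>blurred_sign \<rho> t\<bar>" h] by (simp add: abs_mult)

text \<open>
  The target \<open>s\<close> can differ from the sign of \<open>t\<close> only if the threshold reaches beyond \<open>t\<close>, that is for
  \<open>\<bar>t\<bar> \<le> \<bar>z\<bar>\<close>.
\<close>

lemma chi_square_tilted_pointwise:
  fixes t z :: real
  assumes h: "0 \<le> h" "h \<le> 1" and \<rho>: "0 < \<rho>"
  defines "s \<equiv> (if 0 \<le> t + z then 1 else -1 :: real)"
  shows "(h * s - h * blurred_sign \<rho> t)\<^sup>2 / (1 - (h * blurred_sign \<rho> t)\<^sup>2)
    \<le> h\<^sup>2 * (\<rho>\<^sup>2 / (\<rho>\<^sup>2 + t\<^sup>2) + 2 * (1 + t\<^sup>2 / \<rho>\<^sup>2) * indicator {- \<bar>z\<bar>..\<bar>z\<bar>} t)"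
proof -
  define m where "m = t\<^sup>2 / (\<rho>\<^sup>2 + t\<^sup>2)"
  define s0 where "s0 = (if 0 \<le> t then 1 else -1 :: real)"
  have pos: "0 < \<rho>\<^sup>2 + t\<^sup>2" using \<rho> by (simp add: add_pos_nonneg)
  have m: "0 \<le> m" "m < 1" using \<rho> pos by (auto simp: m_def)
  have r: "1 - m = \<rho>\<^sup>2 / (\<rho>\<^sup>2 + t\<^sup>2)" "2 / (1 - m) = 2 * (1 + t\<^sup>2 / \<rho>\<^sup>2)"
    using pos \<rho> by (simp_all add: m_def divide_simps)
  have b: "blurred_sign \<rho> t = s0 * m" by (simp add: blurred_sign_def m_def s0_def)
  have sq: "(h * (s0 * m))\<^sup>2 = (h * m)\<^sup>2" by (simp add: power_mult_distrib s0_def)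
  have r0: "0 \<le> 1 - m" "0 \<le> 2 / (1 - m)" using m by auto
  show ?thesis
  proof (cases "s = s0")
    case True
    have "(h * s - h * (s0 * m))\<^sup>2 = (h - h * m)\<^sup>2"
      unfolding True by (auto simp: s0_def power2_eq_square algebra_simps)
    then have "(h * s - h * blurred_sign \<rho> t)\<^sup>2 / (1 - (h * blurred_sign \<rho> t)\<^sup>2) \<le> h\<^sup>2 * (1 - m)"
      using blurred_bias_chi_square(1)[OF h m] by (simp add: b sq)
    also have "\<dots> \<le> h\<^sup>2 * (1 - m + 2 / (1 - m) * indicator {- \<bar>z\<bar>..\<bar>z\<bar>} t)"
      using r0 by (intro mult_left_mono) (auto simp: indicator_def)
    finally show ?thesis unfolding r(2) unfolding r(1) .
  next
    case False
    then have ind: "indicator {- \<bar>z\<bar>..\<bar>z\<bar>} t = (1::real)"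
      by (auto simp: s_def s0_def indicator_def split: if_splits)
    have "(h * s - h * (s0 * m))\<^sup>2 = (h + h * m)\<^sup>2"
      using False by (auto simp: s_def s0_def power2_eq_square algebra_simps split: if_splits)
    then have "(h * s - h * blurred_sign \<rho> t)\<^sup>2 / (1 - (h * blurred_sign \<rho> t)\<^sup>2) \<le> h\<^sup>2 * (2 / (1 - m))"
      using blurred_bias_chi_square(2)[OF h m] by (simp add: b sq)
    also have "\<dots> \<le> h\<^sup>2 * (1 - m + 2 / (1 - m) * indicator {- \<bar>z\<bar>..\<bar>z\<bar>} t)"
      unfolding ind using r0 by (intro mult_left_mono) auto
    finally show ?thesis unfolding r(2) unfolding r(1) .
  qed
qed

text \<open>
  The zeroth coordinate is integrated out first, with the tilt \<open>Z\<close> fixed; this leaves a polynomial in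
  \<open>Z\<^sup>2\<close> and \<open>Z ^ 4\<close>, whose means are \<open>\<rho>\<^sup>2\<close> and at most \<open>3 * \<rho> ^ 4\<close>.
\<close>

lemma chi_square_tilted_halfspace:
  fixes \<epsilon> \<rho> h :: real and T :: "nat set"
  assumes d: "1 \<le> d" and h: "0 \<le> h" "h \<le> 1" and \<rho>: "0 < \<rho>" and \<epsilon>: "\<epsilon>\<^sup>2 * real (d - 1) = \<rho>\<^sup>2"
  defines "p \<equiv> label_density (\<lambda>x. h * of_int (tilted_halfspace d \<epsilon> T x))"
    and "q \<equiv> label_density (\<lambda>x. h * blurred_sign \<rho> (x 0))"
  shows "(\<integral>\<^sup>+z. ennreal ((p z)\<^sup>2 / q z) \<partial>(cube d \<Otimes>\<^sub>M fair_sign)) \<le> ennreal (1 + 4 * h\<^sup>2 * \<rho>)"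
proof -
  define I where "I = {1..<d}"
  define M where "M = PiM I (\<lambda>_. unif)"
  define Z where "Z x = linear_form I (tilt \<epsilon> T) x" for x
  define C where "C x = (h * of_int (tilted_halfspace d \<epsilon> T x) - h * blurred_sign \<rho> (x 0))\<^sup>2 / (1 - (h * blurred_sign \<rho> (x 0))\<^sup>2)" for x
  interpret M: prob_space M unfolding M_def by (intro prob_space_PiM prob_space_unif)
  have I: "finite I" "0 \<notin> I" by (auto simp: I_def)
  have meas: "(\<lambda>t. ennreal (\<rho>\<^sup>2 / (\<rho>\<^sup>2 + t\<^sup>2))) \<in> borel_measurable unif"
    "(\<lambda>t. ennreal (2 * (1 + t\<^sup>2 / \<rho>\<^sup>2)) * indicator {- z..z} t) \<in> borel_measurable unif"
    "(\<lambda>t. ennreal (\<rho>\<^sup>2 / (\<rho>\<^sup>2 + t\<^sup>2)) + ennreal (2 * (1 + t\<^sup>2 / \<rho>\<^sup>2)) * indicator {- z..z} t) \<in> borel_measurable unif"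
    for z :: real by measurable
  have [measurable]: "(\<lambda>x. x 0) \<in> borel_measurable (cube d)"
    using d unfolding cube_def by simp
  have [measurable]: "p \<in> borel_measurable (cube d \<Otimes>\<^sub>M fair_sign)" "q \<in> borel_measurable (cube d \<Otimes>\<^sub>M fair_sign)"
    unfolding p_def q_def by measurable
  have small: "\<bar>h * blurred_sign \<rho> t\<bar> < 1" for t by (rule bias_blurred_sign_less_1[OF \<rho> h])
  have C_meas: "(\<lambda>x. ennreal (1 + C x)) \<in> borel_measurable (cube d)"
    unfolding C_def by measurable
  have Z: "integrable M (\<lambda>x. (Z x)\<^sup>2)" "integrable M (\<lambda>x. Z x ^ 4)" "(\<integral>x. (Z x)\<^sup>2 \<partial>M) = \<rho>\<^sup>2" "(\<integral>x. Z x ^ 4 \<partial>M) \<le> 3 * \<rho> ^ 4"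
    using integrable_linear_form_power[OF I(1)] linear_form_second_moment[OF I(1)] linear_form_fourth_moment[OF I(1), of "tilt \<epsilon> T"]
      sum_tilt_squared[of \<epsilon> T d, folded I_def]
    unfolding Z_def M_def \<epsilon> by (auto simp: power_mult[symmetric])
  have "(\<integral>\<^sup>+z. ennreal ((p z)\<^sup>2 / q z) \<partial>(cube d \<Otimes>\<^sub>M fair_sign)) = (\<integral>\<^sup>+x. ennreal (1 + C x) \<partial>cube d)"
  proof (subst nn_integral_pair_fair_sign)
    show "(\<integral>\<^sup>+x. (ennreal ((p (x, 1))\<^sup>2 / q (x, 1)) + ennreal ((p (x, -1))\<^sup>2 / q (x, -1))) / 2 \<partial>cube d)
        = (\<integral>\<^sup>+x. ennreal (1 + C x) \<partial>cube d)"
    proof (rule nn_integral_cong)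
      fix x
      have nn: "0 \<le> (p (x, 1))\<^sup>2 / q (x, 1)" "0 \<le> (p (x, -1))\<^sup>2 / q (x, -1)"
        using small[of "x 0"] by (auto simp: q_def label_density_def abs_less_iff)
      have "(ennreal ((p (x, 1))\<^sup>2 / q (x, 1)) + ennreal ((p (x, -1))\<^sup>2 / q (x, -1))) / 2
          = ennreal (((p (x, 1))\<^sup>2 / q (x, 1) + (p (x, -1))\<^sup>2 / q (x, -1)) / 2)"
        using nn by (simp add: ennreal_plus[symmetric] ennreal_divide_numeral del: ennreal_plus)
      also have "((p (x, 1))\<^sup>2 / q (x, 1) + (p (x, -1))\<^sup>2 / q (x, -1)) / 2 = 1 + C x"
        using two_point_chi_square[OF small[of "x 0"], of "h * of_int (tilted_halfspace d \<epsilon> T x)"]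
        by (simp add: p_def q_def label_density_def C_def)
      finally show "(ennreal ((p (x, 1))\<^sup>2 / q (x, 1)) + ennreal ((p (x, -1))\<^sup>2 / q (x, -1))) / 2 = ennreal (1 + C x)" .
    qed
  qed measurable
  also have "\<dots> = (\<integral>\<^sup>+x. \<integral>\<^sup>+t. ennreal (1 + C (x(0 := t))) \<partial>unif \<partial>M)"
    using nn_integral_cube[OF d C_meas] by (simp add: M_def I_def)
  also have "\<dots> \<le> (\<integral>\<^sup>+x. ennreal (1 + h\<^sup>2 * (2 * \<rho> + 8 / 9 * ((Z x)\<^sup>2 / \<rho>) + 2 / 9 * (Z x ^ 4 / \<rho> ^ 3))) \<partial>M)"
  proof (rule nn_integral_mono)
    fix x
    let ?z = "\<bar>Z x\<bar>"
    have "(\<integral>\<^sup>+t. ennreal (1 + C (x(0 := t))) \<partial>unif)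
      \<le> (\<integral>\<^sup>+t. 1 + ennreal (h\<^sup>2) * (ennreal (\<rho>\<^sup>2 / (\<rho>\<^sup>2 + t\<^sup>2)) + ennreal (2 * (1 + t\<^sup>2 / \<rho>\<^sup>2)) * indicator {- ?z..?z} t) \<partial>unif)"
    proof (rule nn_integral_mono)
      fix t
      have "C (x(0 := t)) \<le> h\<^sup>2 * (\<rho>\<^sup>2 / (\<rho>\<^sup>2 + t\<^sup>2) + 2 * (1 + t\<^sup>2 / \<rho>\<^sup>2) * indicator {- ?z..?z} t)"
        using chi_square_tilted_pointwise[OF h \<rho>, of t "Z x"] d I
        by (simp add: C_def tilted_halfspace_eq Z_def linear_form_update_other I_def if_distrib[of of_int] cong: if_cong)
      then have "ennreal (1 + C (x(0 := t))) \<le> ennreal (1 + h\<^sup>2 * (\<rho>\<^sup>2 / (\<rho>\<^sup>2 + t\<^sup>2) + 2 * (1 + t\<^sup>2 / \<rho>\<^sup>2) * indicator {- ?z..?z} t))"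
        by (intro ennreal_leI) simp
      also have "\<dots> = 1 + ennreal (h\<^sup>2) * (ennreal (\<rho>\<^sup>2 / (\<rho>\<^sup>2 + t\<^sup>2)) + ennreal (2 * (1 + t\<^sup>2 / \<rho>\<^sup>2)) * indicator {- ?z..?z} t)"
        by (auto simp: indicator_def ennreal_mult)
      finally show "ennreal (1 + C (x(0 := t)))
        \<le> 1 + ennreal (h\<^sup>2) * (ennreal (\<rho>\<^sup>2 / (\<rho>\<^sup>2 + t\<^sup>2)) + ennreal (2 * (1 + t\<^sup>2 / \<rho>\<^sup>2)) * indicator {- ?z..?z} t)" .
    qed
    also have "\<dots> = 1 + ennreal (h\<^sup>2) * ((\<integral>\<^sup>+t. ennreal (\<rho>\<^sup>2 / (\<rho>\<^sup>2 + t\<^sup>2)) \<partial>unif)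
        + (\<integral>\<^sup>+t. ennreal (2 * (1 + t\<^sup>2 / \<rho>\<^sup>2)) * indicator {- ?z..?z} t \<partial>unif))"
      using unif.emeasure_space_1 meas
      by (simp add: nn_integral_add nn_integral_cmult)
    also have "\<dots> \<le> 1 + ennreal (h\<^sup>2) * (ennreal (4 / 3 * \<rho>) + ennreal (2 / 3 * \<rho> + 8 / 9 * (?z\<^sup>2 / \<rho>) + 2 / 9 * (?z ^ 4 / \<rho> ^ 3)))"
      using \<rho> by (intro add_mono mult_left_mono unif_blur unif_blur_inverse) auto
    also have "\<dots> = ennreal (1 + h\<^sup>2 * (4 / 3 * \<rho> + (2 / 3 * \<rho> + 8 / 9 * (?z\<^sup>2 / \<rho>) + 2 / 9 * (?z ^ 4 / \<rho> ^ 3))))"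
    proof -
      have "1 + ennreal a * (ennreal u + ennreal v) = ennreal (1 + a * (u + v))" if "0 \<le> a" "0 \<le> u" "0 \<le> v" for a u v
        using that by (simp add: ennreal_mult)
      then show ?thesis by this (use \<rho> in auto)
    qed
    also have "4 / 3 * \<rho> + (2 / 3 * \<rho> + 8 / 9 * (?z\<^sup>2 / \<rho>) + 2 / 9 * (?z ^ 4 / \<rho> ^ 3)) = 2 * \<rho> + 8 / 9 * ((Z x)\<^sup>2 / \<rho>) + 2 / 9 * (Z x ^ 4 / \<rho> ^ 3)"
      by simp
    finally show "(\<integral>\<^sup>+t. ennreal (1 + C (x(0 := t))) \<partial>unif) \<le> ennreal (1 + h\<^sup>2 * (2 * \<rho> + 8 / 9 * ((Z x)\<^sup>2 / \<rho>) + 2 / 9 * (Z x ^ 4 / \<rho> ^ 3)))" .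
  qed
  also have "\<dots> = ennreal (\<integral>x. 1 + h\<^sup>2 * (2 * \<rho> + 8 / 9 * ((Z x)\<^sup>2 / \<rho>) + 2 / 9 * (Z x ^ 4 / \<rho> ^ 3)) \<partial>M)"
    using Z(1,2) \<rho> by (intro nn_integral_eq_integral AE_I2) auto
  also have "\<dots> = ennreal (1 + h\<^sup>2 * (2 * \<rho> + 8 / 9 * (\<rho>\<^sup>2 / \<rho>) + 2 / 9 * ((\<integral>x. Z x ^ 4 \<partial>M) / \<rho> ^ 3)))"
    using Z(1-3) by (simp add: M.prob_space)
  also have "\<dots> \<le> ennreal (1 + h\<^sup>2 * (2 * \<rho> + 8 / 9 * (\<rho>\<^sup>2 / \<rho>) + 2 / 9 * ((3 * \<rho> ^ 4) / \<rho> ^ 3)))"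
    using Z(4) \<rho> by (intro ennreal_leI add_left_mono mult_left_mono divide_right_mono) auto
  also have "\<dots> \<le> ennreal (1 + 4 * h\<^sup>2 * \<rho>)"
  proof (rule ennreal_leI)
    have "2 * \<rho> + 8 / 9 * (\<rho>\<^sup>2 / \<rho>) + 2 / 9 * ((3 * \<rho> ^ 4) / \<rho> ^ 3) = 32 / 9 * \<rho>"
      using \<rho> by (simp add: field_simps eval_nat_numeral)
    also have "\<dots> \<le> 4 * \<rho>" using \<rho> by simp
    finally have "h\<^sup>2 * (2 * \<rho> + 8 / 9 * (\<rho>\<^sup>2 / \<rho>) + 2 / 9 * ((3 * \<rho> ^ 4) / \<rho> ^ 3)) \<le> h\<^sup>2 * (4 * \<rho>)"
      by (intro mult_left_mono) auto
    then show "1 + h\<^sup>2 * (2 * \<rho> + 8 / 9 * (\<rho>\<^sup>2 / \<rho>) + 2 / 9 * ((3 * \<rho> ^ 4) / \<rho> ^ 3)) \<le> 1 + 4 * h\<^sup>2 * \<rho>"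
      by simp
  qed
  finally show ?thesis .
qed

section \<open>The lower bound\<close>

lemma sets_examples: "sets (examples d) = sets (cube d \<Otimes>\<^sub>M fair_sign)"
  unfolding examples_def labels_def
  by (intro sets_pair_measure_cong) (auto simp: sets_cube sets_uniform_count_measure)

lemma sets_labels: "sets labels = sets fair_sign"
  by (simp add: labels_def sets_uniform_count_measure)

abbreviation tilted_distribution :: "nat \<Rightarrow> real \<Rightarrow> real \<Rightarrow> nat set \<Rightarrow> ((nat \<Rightarrow> real) \<times> int) measure" where
  "tilted_distribution d h \<epsilon> T \<equiv> label_noise (cube d) (\<lambda>x. h * of_int (tilted_halfspace d \<epsilon> T x))"

text \<open>
  The target minimises the risk, and the Bernstein condition holds with equality, because both moments of the
  excess loss are multiples of the probability of disagreement.
\<close>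

lemma halfspace_noise_valid:
  assumes d: "1 \<le> d" and h: "0 \<le> h" "h \<le> 1" "B * h = 1" "1 < B"
    and fstar: "fstar \<in> homogeneous_halfspaces d"
  defines "P \<equiv> label_noise (cube d) (\<lambda>x. h * of_int (fstar x))"
  shows "prob_space P" "sets P = sets (examples d)" "distr P (Rd d) fst = cube d"
    "risk_minimizer P (homogeneous_halfspaces d) fstar"
    "bernstein_class P (excess_loss_class (homogeneous_halfspaces d) fstar) 1 B"
proof -
  have meas: "f \<in> measurable (cube d) fair_sign" if "f \<in> homogeneous_halfspaces d" for f
    using that by (auto simp: homogeneous_halfspaces_def)
  note [measurable] = meas[OF fstar]
  have bound: "\<bar>h * of_int (fstar x)\<bar> \<le> 1" if "x \<in> space (cube d)" for x
    by (rule bias_le_1[OF prob_space_cube meas[OF fstar] meas[OF fstar] h(1,2) that])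
  show "prob_space P"
    unfolding P_def by (rule prob_space_label_noise[OF prob_space_cube _ bound]) measurable
  show "sets P = sets (examples d)"
    by (simp add: P_def sets_label_noise sets_examples)
  show "distr P (Rd d) fst = cube d"
    unfolding P_def by (rule distr_fst_label_noise[OF _ bound]) (auto simp: sets_cube)
  show "risk_minimizer P (homogeneous_halfspaces d) fstar"
    unfolding risk_minimizer_def
  proof (intro conjI ballI fstar)
    fix f assume "f \<in> homogeneous_halfspaces d"
    have "0 \<le> h * measure (cube d) {x \<in> space (cube d). f x \<noteq> fstar x}" using h by simp
    also have "\<dots> = risk P f - risk P fstar"
      unfolding P_def
      by (rule excess_risk_label_noise[OF prob_space_cube meas[OF fstar] meas h(1,2), symmetric]) fact
    finally show "risk P fstar \<le> risk P f" by simp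
  qed
  show "bernstein_class P (excess_loss_class (homogeneous_halfspaces d) fstar) 1 B"
    unfolding bernstein_class_def
  proof (intro conjI ballI)
    fix g assume "g \<in> excess_loss_class (homogeneous_halfspaces d) fstar"
    then obtain f where f: "f \<in> homogeneous_halfspaces d"
      and g: "g = (\<lambda>z. binary_loss (f (fst z)) (snd z) - binary_loss (fstar (fst z)) (snd z))"
      unfolding excess_loss_class_def case_prod_beta by blast
    let ?m = "measure (cube d) {x \<in> space (cube d). f x \<noteq> fstar x}"
    have mean: "(\<integral>z. g z \<partial>P) = h * ?m"
      unfolding g P_def by (rule excess_loss_mean[OF prob_space_cube meas[OF fstar] meas[OF f] h(1,2)])
    have "(\<integral>z. (g z)\<^sup>2 \<partial>P) = ?m"
      unfolding g P_def by (rule excess_loss_second_moment[OF prob_space_cube meas[OF fstar] meas[OF f] h(1,2)])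
    also have "\<dots> = B * (h * ?m)" using h(3) by (simp only: mult.assoc[symmetric] mult_1)
    also have "\<dots> = B * (if (1::real) = 0 then 1 else (\<integral>z. g z \<partial>P) powr 1)"
      unfolding mean using h by simp
    finally show "(\<integral>z. (g z)\<^sup>2 \<partial>P) \<le> B * (if (1::real) = 0 then 1 else (\<integral>z. g z \<partial>P) powr 1)"
      by (rule eq_refl)
  qed (use h in auto)
qed

lemma tilted_halfspace_homogeneous: "1 \<le> d \<Longrightarrow> tilted_halfspace d \<epsilon> T \<in> homogeneous_halfspaces d"
  unfolding homogeneous_halfspaces_def by (auto simp: tilt_def intro!: exI[of _ "tilt \<epsilon> T"] exI[of _ 0])

text \<open>
  Two targets near \<open>f\<close> are near each other by the triangle inequality, so all of them lie in a Hamming ball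
  around any one of them. The classifier \<open>f\<close> itself may be arbitrary.
\<close>

lemma few_tilted_halfspaces_near:
  assumes d: "2 \<le> d" and \<rho>: "0 < \<rho>" "\<rho> \<le> 1 / 40" and \<epsilon>: "0 < \<epsilon>" "\<epsilon>\<^sup>2 * real (d - 1) = \<rho>\<^sup>2"
    and f: "f \<in> measurable (cube d) fair_sign"
  shows "real (card {T \<in> Pow {1..<d}. measure (cube d) {x \<in> space (cube d). f x \<noteq> tilted_halfspace d \<epsilon> T x} \<le> \<rho> / 48})
    \<le> (3 / 4) ^ (d - 1) * real (card (Pow {1..<d}))"
    (is "real (card ?N) \<le> _")
proof (cases "?N = {}")
  case True
  show ?thesis unfolding True by simp
next
  case False
  interpret C: prob_space "cube d" by (rule prob_space_cube)
  obtain T0 where T0: "T0 \<subseteq> {1..<d}"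
    "measure (cube d) {x \<in> space (cube d). f x \<noteq> tilted_halfspace d \<epsilon> T0 x} \<le> \<rho> / 48"
    using False by auto
  have \<rho>\<epsilon>: "\<rho> = \<epsilon> * sqrt (real (d - 1))"
  proof -
    have "\<rho> = sqrt (\<rho>\<^sup>2)" using \<rho> by simp
    also have "\<dots> = \<epsilon> * sqrt (real (d - 1))" unfolding \<epsilon>(2)[symmetric] using \<epsilon>(1) by (simp add: real_sqrt_mult)
    finally show ?thesis .
  qed
  have small: "\<epsilon>\<^sup>2 * real (d - 1) \<le> 1 / 1600"
  proof -
    have "\<rho>\<^sup>2 \<le> (1 / 40)\<^sup>2" using \<rho> by (intro power_mono) auto
    then show ?thesis using \<epsilon> by (simp add: power2_eq_square)
  qed
  have "?N \<subseteq> {T \<in> Pow {1..<d}. 9 * card (sym_diff T T0) \<le> card {1..<d}}"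
  proof safe
    fix T assume T: "T \<subseteq> {1..<d}"
      "measure (cube d) {x \<in> space (cube d). f x \<noteq> tilted_halfspace d \<epsilon> T x} \<le> \<rho> / 48"
    let ?D = "\<lambda>g g' :: _ \<Rightarrow> int. {x \<in> space (cube d). g x \<noteq> g' x}"
    have sets: "?D g g' \<in> sets (cube d)"
      if "g \<in> measurable (cube d) fair_sign" "g' \<in> measurable (cube d) fair_sign" for g g'
      using measurable_disagree[OF that(2,1)] by simp
    have "\<epsilon> * sqrt (real (card (sym_diff T T0))) / 8
        \<le> measure (cube d) (?D (tilted_halfspace d \<epsilon> T) (tilted_halfspace d \<epsilon> T0))"
      using d \<epsilon> small T T0 by (intro tilted_halfspaces_separated) auto
    also have "\<dots> \<le> measure (cube d) (?D f (tilted_halfspace d \<epsilon> T) \<union> ?D f (tilted_halfspace d \<epsilon> T0))"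
      using f by (intro C.finite_measure_mono sets.Un sets) auto
    also have "\<dots> \<le> measure (cube d) (?D f (tilted_halfspace d \<epsilon> T)) + measure (cube d) (?D f (tilted_halfspace d \<epsilon> T0))"
      using f by (intro measure_Un_le sets) auto
    also have "\<dots> \<le> \<rho> / 24" using T T0 by simp
    \<comment> \<open>The radius \<open>\<rho> / 48\<close> is chosen such that twice it corresponds to Hamming distance \<open>(d - 1) / 9\<close>.\<close>
    finally have "sqrt (real (card (sym_diff T T0))) * (3 * \<epsilon>) \<le> sqrt (real (d - 1)) * \<epsilon>"
      unfolding \<rho>\<epsilon> by (simp add: mult.commute)
    then have "3 * sqrt (real (card (sym_diff T T0))) \<le> sqrt (real (d - 1))"
      using \<epsilon>(1) by simp
    then have "(3 * sqrt (real (card (sym_diff T T0))))\<^sup>2 \<le> (sqrt (real (d - 1)))\<^sup>2"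
      by (intro power_mono) auto
    then have "9 * real (card (sym_diff T T0)) \<le> real (d - 1)"
      by (simp add: power_mult_distrib)
    then show "9 * card (sym_diff T T0) \<le> card {1..<d}" by simp
  qed
  then have "card ?N \<le> card {T \<in> Pow {1..<d}. 9 * card (sym_diff T T0) \<le> card {1..<d}}"
    by (intro card_mono) auto
  also have "real \<dots> \<le> (3 / 4) ^ card {1..<d} * 2 ^ card {1..<d}"
    using T0 by (intro hamming_ball_card) auto
  finally show ?thesis by (simp add: card_Pow)
qed

lemma measurable_classifier:
  assumes A: "learning_algorithm d n A"
  shows "(\<lambda>z. A (fst z) (snd z)) \<in> measurable (PiM {..<n} (\<lambda>_. cube d \<Otimes>\<^sub>M fair_sign) \<Otimes>\<^sub>M cube d) fair_sign"
proof -
  have "sets (PiM {..<n} (\<lambda>_. examples d) \<Otimes>\<^sub>M Rd d) = sets (PiM {..<n} (\<lambda>_. cube d \<Otimes>\<^sub>M fair_sign) \<Otimes>\<^sub>M cube d)"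
    by (intro sets_pair_measure_cong sets_PiM_cong) (auto simp: sets_examples sets_cube)
  then show ?thesis
    using A measurable_cong_sets[OF _ sets_labels] unfolding learning_algorithm_def case_prod_beta by blast
qed

text \<open>
  The choice \<open>\<theta> = (5/6) ^ m\<close> nearly balances the two error terms for \<open>K = (13/12) ^ m\<close> and
  \<open>\<kappa> = (3/4) ^ m\<close>: they become \<open>(65/72) ^ m / 2\<close> and \<open>(9/10) ^ m / 2\<close>, with a sum below \<open>91/100\<close> already
  for \<open>m = 1\<close>.
\<close>

lemma some_tilted_halfspace_hard:
  assumes d: "2 \<le> d" and A: "learning_algorithm d n A"
    and h: "0 \<le> h" "h \<le> 1" and \<rho>: "0 < \<rho>" "\<rho> \<le> 1 / 40" "60 * real n * h\<^sup>2 * \<rho> \<le> real (d - 1)"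
    and \<epsilon>: "0 < \<epsilon>" "\<epsilon>\<^sup>2 * real (d - 1) = \<rho>\<^sup>2"
  shows "\<exists>T\<subseteq>{1..<d}. (\<integral>S. measure (cube d) {x \<in> space (cube d). A S x \<noteq> tilted_halfspace d \<epsilon> T x}
    \<partial>PiM {..<n} (\<lambda>_. tilted_distribution d h \<epsilon> T)) \<ge> 9 / 100 * (\<rho> / 48)"
proof -
  define m where "m = d - 1"
  define base where "base = cube d \<Otimes>\<^sub>M fair_sign"
  define \<Lambda> where "\<Lambda> = PiM {..<n} (\<lambda>_. base)"
  define p where "p T = label_density (\<lambda>x. h * of_int (tilted_halfspace d \<epsilon> T x))" for T
  define q where "q = label_density (\<lambda>x. h * blurred_sign \<rho> (x (0::nat)))"
  define g where "g T S = (\<Prod>i<n. p T (S i))" for T and S :: "nat \<Rightarrow> (nat \<Rightarrow> real) \<times> int"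
  define qn where "qn S = (\<Prod>i<n. q (S i))" for S :: "nat \<Rightarrow> (nat \<Rightarrow> real) \<times> int"
  define D where "D T S = measure (cube d) {x \<in> space (cube d). A S x \<noteq> tilted_halfspace d \<epsilon> T x}" for T S
  interpret C: prob_space "cube d" by (rule prob_space_cube)
  interpret F: prob_space fair_sign by (rule prob_space_fair_sign)
  interpret CF: pair_prob_space "cube d" fair_sign ..
  interpret B: prob_space base unfolding base_def by (rule CF.prob_space_axioms)
  interpret Bs: product_sigma_finite "\<lambda>_::nat. base" ..
  have [measurable]: "(\<lambda>x. x 0) \<in> borel_measurable (cube d)"
    using d unfolding cube_def by simp
  have p_bias: "\<bar>h * of_int (tilted_halfspace d \<epsilon> T x)\<bar> \<le> 1" if "x \<in> space (cube d)" for T x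
    by (rule bias_le_1[OF prob_space_cube measurable_halfspace measurable_halfspace h that])
  have q_bias: "\<bar>h * blurred_sign \<rho> t\<bar> < 1" for t by (rule bias_blurred_sign_less_1[OF \<rho>(1) h])
  have [measurable]: "p T \<in> borel_measurable base" "q \<in> borel_measurable base" for T
    unfolding p_def q_def base_def by measurable
  have p: "integrable base (p T)" "(\<integral>z. p T z \<partial>base) = 1" for T
    unfolding p_def base_def by (rule integral_label_density[OF prob_space_cube _ p_bias]; measurable)+
  have q: "integrable base q" "(\<integral>z. q z \<partial>base) = 1"
    unfolding q_def base_def
    by (rule integral_label_density[OF prob_space_cube _ less_imp_le[OF q_bias]]; measurable)+
  have p_nonneg: "0 \<le> p T z" if "z \<in> space base" for T z
    unfolding p_def
    by (rule label_density_nonneg[where \<mu> = "cube d"]) (use p_bias that in \<open>auto simp: base_def\<close>)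
  have q_pos: "0 < q z" if "z \<in> space base" for z
    using that q_bias[of "fst z 0"]
    by (auto simp: q_def label_density_def base_def space_pair_measure space_uniform_count_measure abs_less_iff)
  have chi_nn: "(\<integral>\<^sup>+z. ennreal ((p T z)\<^sup>2 / q z) \<partial>base) \<le> ennreal (1 + 4 * h\<^sup>2 * \<rho>)" for T
    unfolding p_def q_def base_def using d by (intro chi_square_tilted_halfspace h \<rho> \<epsilon>) auto
  have chi: "integrable base (\<lambda>z. (p T z)\<^sup>2 / q z)" "(\<integral>z. (p T z)\<^sup>2 / q z \<partial>base) \<le> 1 + 4 * h\<^sup>2 * \<rho>"
     "0 \<le> (\<integral>z. (p T z)\<^sup>2 / q z \<partial>base)" for T
  proof -
    have nn: "AE z in base. 0 \<le> (p T z)\<^sup>2 / q z"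
      using q_pos by (intro AE_I2) (simp add: less_imp_le)
    show "integrable base (\<lambda>z. (p T z)\<^sup>2 / q z)"
      using le_less_trans[OF chi_nn[of T]] by (intro integrableI_nonneg nn) auto
    show "(\<integral>z. (p T z)\<^sup>2 / q z \<partial>base) \<le> 1 + 4 * h\<^sup>2 * \<rho>"
      using chi_nn[of T] h \<rho> by (intro integral_real_bounded) auto
    show "0 \<le> (\<integral>z. (p T z)\<^sup>2 / q z \<partial>base)" by (rule integral_nonneg_AE[OF nn])
  qed
  have space: "S i \<in> space base" if "S \<in> space \<Lambda>" "i < n" for S i
    using that by (auto simp: \<Lambda>_def space_PiM PiE_iff)
  have K: "(\<integral>S. (g T S)\<^sup>2 / qn S \<partial>\<Lambda>) \<le> (13 / 12) ^ m" "integrable \<Lambda> (\<lambda>S. (g T S)\<^sup>2 / qn S)" for T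
  proof -
    have eq: "(g T S)\<^sup>2 / qn S = (\<Prod>i<n. (p T (S i))\<^sup>2 / q (S i))" for S
      unfolding g_def qn_def by (simp add: prod_dividef prod_power_distrib)
    show "integrable \<Lambda> (\<lambda>S. (g T S)\<^sup>2 / qn S)"
      unfolding eq \<Lambda>_def by (intro Bs.product_integrable_prod chi) auto
    have "(\<integral>S. (g T S)\<^sup>2 / qn S \<partial>\<Lambda>) = (\<Prod>i<n. \<integral>z. (p T z)\<^sup>2 / q z \<partial>base)"
      unfolding eq \<Lambda>_def by (intro Bs.product_integral_prod chi) auto
    also have "\<dots> \<le> (1 + 4 * h\<^sup>2 * \<rho>) ^ n"
      using chi(2,3)[of T] by (simp add: power_mono)
    also have "\<dots> \<le> exp (4 * h\<^sup>2 * \<rho>) ^ n"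
      using \<rho> by (intro power_mono) auto
    also have "\<dots> = exp (real n * (4 * h\<^sup>2 * \<rho>))" by (simp add: exp_of_nat_mult)
    also have "\<dots> \<le> exp (real m * (1 / 15))"
      using \<rho>(3) by (simp add: m_def mult_ac)
    also have "\<dots> = exp (1 / 15) ^ m" by (rule exp_of_nat_mult)
    also have "\<dots> \<le> (13 / 12) ^ m"
      using exp_bound[of "1 / 15 :: real"] by (intro power_mono) (auto simp: power2_eq_square)
    finally show "(\<integral>S. (g T S)\<^sup>2 / qn S \<partial>\<Lambda>) \<le> (13 / 12) ^ m" .
  qed
  have A_meas: "(\<lambda>z. A (fst z) (snd z)) \<in> measurable (\<Lambda> \<Otimes>\<^sub>M cube d) fair_sign"
    unfolding \<Lambda>_def base_def by (rule measurable_classifier[OF A])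
  have AS_meas: "A S \<in> measurable (cube d) fair_sign" if "S \<in> space \<Lambda>" for S
    using measurable_compose[OF measurable_Pair1'[OF that] A_meas] by simp
  have D_meas: "D T \<in> borel_measurable \<Lambda>" for T
  proof -
    have "Measurable.pred (\<Lambda> \<Otimes>\<^sub>M cube d) (\<lambda>z. A (fst z) (snd z) \<noteq> tilted_halfspace d \<epsilon> T (snd z))"
      by (rule measurable_disagree[OF _ A_meas]) measurable
    then have "(\<lambda>S. measure (cube d) (Pair S -` {z \<in> space (\<Lambda> \<Otimes>\<^sub>M cube d). A (fst z) (snd z) \<noteq> tilted_halfspace d \<epsilon> T (snd z)})) \<in> borel_measurable \<Lambda>"
      unfolding measure_def by (intro borel_measurable_enn2real C.measurable_emeasure_Pair) simp
    moreover have "D T S = measure (cube d) (Pair S -` {z \<in> space (\<Lambda> \<Otimes>\<^sub>M cube d). A (fst z) (snd z) \<noteq> tilted_halfspace d \<epsilon> T (snd z)})"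
      if "S \<in> space \<Lambda>" for S
      using that unfolding D_def by (intro arg_cong[where f = "measure (cube d)"]) (auto simp: space_pair_measure)
    ultimately show ?thesis by (simp cong: measurable_cong)
  qed
  let ?\<theta> = "(5 / 6 :: real) ^ m" and ?\<kappa> = "(3 / 4 :: real) ^ m" and ?K = "(13 / 12 :: real) ^ m"
  have avg: "real (card (Pow {1..<d})) * (\<rho> / 48 * (1 - ?\<theta> * ?K / 2 - ?\<kappa> / (2 * ?\<theta>)))
      \<le> (\<Sum>T\<in>Pow {1..<d}. \<integral>S. D T S * g T S \<partial>\<Lambda>)"
  proof (rule weighted_average_lower_bound[where q = qn])
    fix T
    show "integrable \<Lambda> (g T)" "(\<integral>S. g T S \<partial>\<Lambda>) = 1"
      using Bs.product_integrable_prod[of "{..<n}" "\<lambda>_. p T"] Bs.product_integral_prod[of "{..<n}" "\<lambda>_. p T"] p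
      unfolding g_def \<Lambda>_def by auto
    show "0 \<le> g T S" if "S \<in> space \<Lambda>" for S
      unfolding g_def using p_nonneg space[OF that] by (intro prod_nonneg) auto
    show "0 \<le> D T S \<and> D T S \<le> 1" for S by (simp add: D_def)
  next
    show "integrable \<Lambda> qn" "(\<integral>S. qn S \<partial>\<Lambda>) = 1"
      using Bs.product_integrable_prod[of "{..<n}" "\<lambda>_. q"] Bs.product_integral_prod[of "{..<n}" "\<lambda>_. q"] q
      unfolding qn_def \<Lambda>_def by auto
    show "0 < qn S" if "S \<in> space \<Lambda>" for S
      unfolding qn_def using q_pos space[OF that] by (intro prod_pos) auto
    fix S assume "S \<in> space \<Lambda>"
    then show "real (card {T \<in> Pow {1..<d}. D T S \<le> \<rho> / 48}) \<le> ?\<kappa> * real (card (Pow {1..<d}))"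
      unfolding D_def m_def by (intro few_tilted_halfspaces_near d \<rho> \<epsilon> AS_meas)
  qed (use K D_meas \<rho> in auto)
  have num: "9 / 100 \<le> 1 - ?\<theta> * ?K / 2 - ?\<kappa> / (2 * ?\<theta>)"
  proof -
    have pow: "r ^ m \<le> r" if "0 \<le> r" "r \<le> 1" for r :: real
      using d that power_decreasing[of 1 m r] by (simp add: m_def)
    have "?\<theta> * ?K = (65 / 72) ^ m" by (simp add: power_mult_distrib[symmetric])
    moreover have "?\<kappa> / ?\<theta> = (9 / 10) ^ m" by (simp add: power_divide[symmetric])
    moreover have "?\<kappa> / (2 * ?\<theta>) = ?\<kappa> / ?\<theta> / 2" by simp
    ultimately show ?thesis using pow[of "65 / 72"] pow[of "9 / 10"] by linarith
  qed
  have "(\<Sum>T\<in>Pow {1..<d}. \<rho> / 48 * (9 / 100)) = real (card (Pow {1..<d})) * (\<rho> / 48 * (9 / 100))"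
    by simp
  also have "\<dots> \<le> real (card (Pow {1..<d})) * (\<rho> / 48 * (1 - ?\<theta> * ?K / 2 - ?\<kappa> / (2 * ?\<theta>)))"
    using num \<rho>(1) by (intro mult_left_mono) auto
  also note avg
  finally have sum: "(\<Sum>T\<in>Pow {1..<d}. \<rho> / 48 * (9 / 100)) \<le> (\<Sum>T\<in>Pow {1..<d}. \<integral>S. D T S * g T S \<partial>\<Lambda>)" .
  have "\<exists>T\<in>Pow {1..<d}. \<rho> / 48 * (9 / 100) \<le> (\<integral>S. D T S * g T S \<partial>\<Lambda>)"
  proof (rule ccontr)
    assume "\<not> ?thesis"
    then have "(\<Sum>T\<in>Pow {1..<d}. \<integral>S. D T S * g T S \<partial>\<Lambda>) < (\<Sum>T\<in>Pow {1..<d}. \<rho> / 48 * (9 / 100))"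
      by (intro sum_strict_mono) (auto simp: not_le)
    with sum show False by simp
  qed
  then obtain T where T: "T \<subseteq> {1..<d}" "\<rho> / 48 * (9 / 100) \<le> (\<integral>S. D T S * g T S \<partial>\<Lambda>)" by auto
  have dens: "tilted_distribution d h \<epsilon> T = density base (\<lambda>z. ennreal (p T z))"
    by (simp add: label_noise_def base_def p_def)
  have "prob_space (density base (\<lambda>z. ennreal (p T z)))"
    unfolding dens[symmetric] by (rule prob_space_label_noise[OF prob_space_cube _ p_bias]) measurable
  then have PiM: "PiM {..<n} (\<lambda>_. tilted_distribution d h \<epsilon> T) = density \<Lambda> (\<lambda>S. ennreal (g T S))"
    unfolding dens \<Lambda>_def g_def
    by (intro PiM_density p_nonneg B.sigma_finite_measure_axioms) (auto simp: prob_space_imp_sigma_finite)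
  have [measurable]: "g T \<in> borel_measurable \<Lambda>" unfolding g_def \<Lambda>_def by measurable
  have "(\<integral>S. D T S \<partial>PiM {..<n} (\<lambda>_. tilted_distribution d h \<epsilon> T)) = (\<integral>S. g T S *\<^sub>R D T S \<partial>\<Lambda>)"
    unfolding PiM
  proof (intro integral_density D_meas AE_I2)
    fix S assume "S \<in> space \<Lambda>"
    then show "0 \<le> g T S"
      unfolding g_def using p_nonneg space by (intro prod_nonneg) blast
  qed measurable
  with T show ?thesis unfolding D_def by (auto simp: mult.commute)
qed

theorem proposition11:
  "\<exists>c::real. c > 0 \<and>
     (\<forall>d n :: nat. \<forall>A. \<forall>B::real.
        d \<ge> 2 \<longrightarrow> learning_algorithm d n A \<longrightarrow> 1 < B \<longrightarrow> B \<le> sqrt (real n / real d) \<longrightarrow>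
        (\<exists>P fstar.
           prob_space P \<and> sets P = sets (examples d) \<and>
           risk_minimizer P (homogeneous_halfspaces d) fstar \<and>
           bernstein_class P (excess_loss_class (homogeneous_halfspaces d) fstar) 1 B \<and>
           zero_mean d (distr P (Rd d) fst) \<and>
           isotropic d (distr P (Rd d) fst) \<and>
           log_concave_distribution d (distr P (Rd d) fst) \<and>
           (\<integral>S. (risk P (A S) - risk P fstar) \<partial>(\<Pi>\<^sub>M i\<in>{..<n}. P)) \<ge> c * (B * real d / real n)))"
proof (intro exI[of _ "1 / 100000 :: real"] conjI allI impI)
  fix d n :: nat and A :: "(nat \<Rightarrow> (nat \<Rightarrow> real) \<times> int) \<Rightarrow> (nat \<Rightarrow> real) \<Rightarrow> int" and B :: real
  assume d: "d \<ge> 2" and A: "learning_algorithm d n A" and B: "1 < B" "B \<le> sqrt (real n / real d)"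
  have "B\<^sup>2 \<le> (sqrt (real n / real d))\<^sup>2" using B by (intro power_mono) auto
  then have "B\<^sup>2 \<le> real n / real d" by simp
  then have Bn: "B\<^sup>2 * real d \<le> real n" using d by (simp add: le_divide_eq)
  have "0 < B\<^sup>2 * real d" using B d by auto
  then have n: "0 < real n" using Bn by linarith
  define m where "m = real (d - 1)"
  have m: "1 \<le> m" "real d \<le> 2 * m" "m \<le> real d" using d by (auto simp: m_def)
  define h where "h = 1 / B"
  have h: "0 \<le> h" "h \<le> 1" "B * h = 1" using B by (auto simp: h_def)
  \<comment> \<open>The scale at which the chi-square cost \<open>4 * h\<^sup>2 * \<rho>\<close> per observation adds up to \<open>m / 15\<close>, and \<open>exp (1 / 15) \<le> 13 / 12\<close>.\<close>
  define \<rho> where "\<rho> = m * B\<^sup>2 / (60 * real n)"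
  define \<epsilon> where "\<epsilon> = \<rho> / sqrt m"
  have "m * B\<^sup>2 \<le> real n"
    using Bn mult_right_mono[OF m(3), of "B\<^sup>2"] by (simp add: mult.commute)
  moreover have "60 * real n * h\<^sup>2 * \<rho> = m"
    using n B by (simp add: \<rho>_def h_def power_divide)
  ultimately have \<rho>: "0 < \<rho>" "\<rho> \<le> 1 / 40" "60 * real n * h\<^sup>2 * \<rho> \<le> real (d - 1)"
    using n m B unfolding m_def[symmetric] by (auto simp: \<rho>_def divide_le_eq)
  have \<epsilon>: "0 < \<epsilon>" "\<epsilon>\<^sup>2 * real (d - 1) = \<rho>\<^sup>2"
    unfolding m_def[symmetric] using \<rho>(1) m by (auto simp: \<epsilon>_def power_divide)
  obtain T where T: "T \<subseteq> {1..<d}" "9 / 100 * (\<rho> / 48) \<le>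
      (\<integral>S. measure (cube d) {x \<in> space (cube d). A S x \<noteq> tilted_halfspace d \<epsilon> T x} \<partial>PiM {..<n} (\<lambda>_. tilted_distribution d h \<epsilon> T))"
    using some_tilted_halfspace_hard[OF d A h(1,2) \<rho> \<epsilon>] by auto
  define P where "P = tilted_distribution d h \<epsilon> T"
  define fstar where "fstar = tilted_halfspace d \<epsilon> T"
  have "1 \<le> d" using d by simp
  note valid = halfspace_noise_valid[OF \<open>1 \<le> d\<close> h B(1) tilted_halfspace_homogeneous[OF \<open>1 \<le> d\<close>, of \<epsilon> T],
    folded fstar_def, folded P_def[folded fstar_def]]
  have "(\<integral>S. (risk P (A S) - risk P fstar) \<partial>PiM {..<n} (\<lambda>_. P))
      = (\<integral>S. h * measure (cube d) {x \<in> space (cube d). A S x \<noteq> fstar x} \<partial>PiM {..<n} (\<lambda>_. P))"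
  proof (rule Bochner_Integration.integral_cong[OF refl])
    fix S assume S: "S \<in> space (PiM {..<n} (\<lambda>_. P))"
    have "sets (PiM {..<n} (\<lambda>_. P)) = sets (PiM {..<n} (\<lambda>_. cube d \<Otimes>\<^sub>M fair_sign))"
      by (intro sets_PiM_cong) (auto simp: valid(2) sets_examples)
    then have "S \<in> space (PiM {..<n} (\<lambda>_. cube d \<Otimes>\<^sub>M fair_sign))"
      using S sets_eq_imp_space_eq by blast
    then have "A S \<in> measurable (cube d) fair_sign"
      using measurable_compose[OF measurable_Pair1' measurable_classifier[OF A]] by simp
    then show "risk P (A S) - risk P fstar = h * measure (cube d) {x \<in> space (cube d). A S x \<noteq> fstar x}"
      unfolding P_def fstar_def
      by (intro excess_risk_label_noise prob_space_cube measurable_halfspace h)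
  qed
  also have "\<dots> \<ge> h * (9 / 100 * (\<rho> / 48))"
    using mult_left_mono[OF T(2) h(1)] unfolding P_def fstar_def by simp
  also have "h * (9 / 100 * (\<rho> / 48)) = 9 / 288000 * (m * B / real n)"
    using B n by (simp add: \<rho>_def h_def power2_eq_square)
  also have "9 / 288000 * (m * B / real n) \<ge> 1 / 100000 * (B * real d / real n)"
  proof -
    have "B * real d / real n \<le> B * (2 * m) / real n"
      using m B n by (intro divide_right_mono mult_left_mono) auto
    moreover have "0 \<le> m * B / real n" using m B n by auto
    ultimately show ?thesis by (simp add: mult_ac)
  qed
  finally have "1 / 100000 * (B * real d / real n) \<le> (\<integral>S. (risk P (A S) - risk P fstar) \<partial>PiM {..<n} (\<lambda>_. P))" .
  then show "\<exists>P fstar.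
           prob_space P \<and> sets P = sets (examples d) \<and>
           risk_minimizer P (homogeneous_halfspaces d) fstar \<and>
           bernstein_class P (excess_loss_class (homogeneous_halfspaces d) fstar) 1 B \<and>
           zero_mean d (distr P (Rd d) fst) \<and>
           isotropic d (distr P (Rd d) fst) \<and>
           log_concave_distribution d (distr P (Rd d) fst) \<and>
           (\<integral>S. (risk P (A S) - risk P fstar) \<partial>(\<Pi>\<^sub>M i\<in>{..<n}. P)) \<ge> 1 / 100000 * (B * real d / real n)"
    using valid zero_mean_cube[of d] isotropic_cube[of d] log_concave_cube[of d]
    by (intro exI[of _ P] exI[of _ fstar]) simp
qed simp

end
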